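(* Let $R$ be a commutative unital ring in which $x^2=0$ implies $x=0$, and let $A:=R[t]$, graded with $t$ in degree $1$. Then the only homogeneous double Poisson structures on $A$ are the scalar ($R$-)multiples of the double Poisson brackets determined by $$\{\!\{t,t\}\!\}^{1}=t\otimes 1-1\otimes t,\qquad \{\!\{t,t\}\!\}^{3}=t^2\otimes t-t\otimes t^2=(t\otimes 1-1\otimes t)(t\otimes t),$$ where the superscript is the degree of the element $\{\!\{t,t\}\!\}$. In general, for $\lambda,\mu,\nu\in R$, the double bracket determined by $$\{\!\{t,t\}\!\}=\lambda\,(t\otimes 1-1\otimes t)+\mu\,(t^2\otimes 1-1\otimes t^2)+\nu\,(t^2\otimes t-t\otimes t^2)$$ defines a double Poisson structure on $A$ if and only if $\lambda\nu-\mu^2=0$, and any double Poisson structure on $A$ is of this form.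
   Context: All tensor products are over $R$. The symmetric group $\mathfrak{S}_n$ acts on $A^{\otimes n}$ by $\sigma(a_1\otimes\cdots\otimes a_n)=a_{\sigma^{-1}(1)}\otimes\cdots\otimes a_{\sigma^{-1}(n)}$ and on $\mathrm{Hom}_R(A^{\otimes n},A^{\otimes n})$ by $\sigma\cdot\phi=\sigma\circ\phi\circ\sigma^{-1}$. The cyclic group $\mathbb{Z}/n$ is regarded as the subgroup of $\mathfrak{S}_n$ generated by the cycle $(1\,2\,\cdots\,n)$. A map $\phi\in\mathrm{Hom}_R(A^{\otimes 2},A^{\otimes 2})$ is a derivation with respect to the last variable if $\phi(c\otimes ab)=(a\otimes 1)\phi(c\otimes b)+\phi(c\otimes a)(1\otimes b)$ for all $a,b,c\in A$. A double bracket on $A$ is an $R$-linear map $\phi=\{\!\{-,-\}\!\}:A^{\otimes 2}\to A^{\otimes 2}$, $a\otimes b\mapsto\{\!\{a,b\}\!\}$, which is a derivation with respect to the last variable and satisfies $\tau\circ\phi\circ\tau=-\phi$, where $\tau$ is the transposition of the tensor factors. A double bracket on $R[t]$ is determined by $\{\!\{t,t\}\!\}\in A^{\otimes 2}$. The double Jacobiator of $\phi$ is $\mathfrak{Jac}(\phi):=\sum_{\sigma\in\mathbb{Z}/3}\sigma\cdot\big((\phi\otimes 1_A)\circ(1_A\otimes\phi)\big)$. A double Poisson structure on $A$ is a double bracket $\phi$ with $\mathfrak{Jac}(\phi)=0$. It is homogeneous if, as a map $A^{\otimes 2}\to A^{\otimes 2}$ of graded modules, it is homogeneous of some degree in $\mathbb{Z}$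 (equivalently, $\{\!\{t,t\}\!\}$ is a homogeneous element of $A^{\otimes 2}$).
   Formalization: The two claims that nothing else occurs ("the only homogeneous ..." and "any double Poisson structure is of this form") are proved for R without 2-torsion; they fail otherwise: if 2c=0, c≠0, then {{t,t}}=c(1⊗1) is a homogeneous double Poisson bracket not listed. *)

theory Defs
  imports
    "HOL-Library.Poly_Mapping"
    "HOL-Library.Numeral_Type"
    "HOL-Combinatorics.Transposition"
    "HOL-Computational_Algebra.Polynomial"
begin

section \<open>Tensor powers of the polynomial algebra\<close>

text \<open>
  Let \<open>A = R[t]\<close> be the type \<open>'a poly\<close> over the ring \<open>R\<close> = \<open>'a\<close>.  The tensor power of \<open>A\<close> over \<open>R\<close>
  with factors indexed by the type \<open>'n\<close> is the free \<open>R\<close>-module on the families \<open>'n \<Rightarrow> 'a poly\<close>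
  modulo the submodule generated by the multilinearity relations.  The factors of the tensor
  square and cube are indexed by \<open>1, 2 :: 2\<close> and \<open>1, 2, 3 :: 3\<close>; in these types \<open>2 = 0\<close>
  and \<open>3 = 0\<close> respectively, so \<open>i \<mapsto> i + 1\<close> is the cycle sending the last index to \<open>1\<close>.
\<close>

inductive_set tensor_relations :: "(('n \<Rightarrow> 'a::comm_ring_1 poly) \<Rightarrow>\<^sub>0 'a) set" where
  zero: "0 \<in> tensor_relations"
| add: "Poly_Mapping.single (f(i := p + q)) d - Poly_Mapping.single (f(i := p)) d
          - Poly_Mapping.single (f(i := q)) d \<in> tensor_relations"
| smult: "Poly_Mapping.single (f(i := smult c p)) d - Poly_Mapping.single (f(i := p)) (c * d)
          \<in> tensor_relations"
| diff: "x \<in> tensor_relations \<Longrightarrow> y \<in> tensor_relations \<Longrightarrow> x - y \<in> tensor_relations"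

lemma tensor_relations_uminus: "x \<in> tensor_relations \<Longrightarrow> - x \<in> tensor_relations"
  using tensor_relations.diff[OF tensor_relations.zero] by fastforce

lemma tensor_relations_add:
  "x \<in> tensor_relations \<Longrightarrow> y \<in> tensor_relations \<Longrightarrow> x + y \<in> tensor_relations"
  using tensor_relations.diff[OF _ tensor_relations_uminus] by fastforce

lemma lookup_map_mult: "Poly_Mapping.lookup (Poly_Mapping.map ((*) (c::'a::comm_ring_1)) F) x = c * Poly_Mapping.lookup F x"
  by (simp add: Poly_Mapping.map.rep_eq when_def)

lemma map_mult_diff:
  "Poly_Mapping.map ((*) (c::'a::comm_ring_1)) (F - G)
     = Poly_Mapping.map ((*) c) F - Poly_Mapping.map ((*) c) G"
  by (rule poly_mapping_eqI) (simp add: lookup_map_mult lookup_minus right_diff_distrib)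

lemma tensor_relations_scale:
  "x \<in> tensor_relations \<Longrightarrow> Poly_Mapping.map ((*) c) x \<in> tensor_relations"
proof (induction rule: tensor_relations.induct)
  case (smult f i e p d)
  show ?case
    using tensor_relations.smult[of f i e p "c * d"] by (simp add: map_mult_diff mult.left_commute[of c e d])
next
  case zero
  show ?case
    using map_mult_diff[of c 0 0] tensor_relations.zero by (metis diff_self)
qed (simp_all add: map_mult_diff tensor_relations.intros)

quotient_type (overloaded) ('a, 'n) poly_tensor =
    "('n \<Rightarrow> 'a::comm_ring_1 poly) \<Rightarrow>\<^sub>0 'a" / "\<lambda>x y. x - y \<in> tensor_relations"
proof (rule equivpI)
  show "reflp (\<lambda>x y. x - y \<in> tensor_relations)"
    by (simp add: reflp_def tensor_relations.zero)
  show "symp (\<lambda>x y. x - y \<in> tensor_relations)"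
    unfolding symp_def using tensor_relations_uminus by fastforce
  show "transp (\<lambda>x y. x - y \<in> tensor_relations)"
    unfolding transp_def using tensor_relations_add by fastforce
qed

instantiation poly_tensor :: (comm_ring_1, type) ab_group_add
begin

lift_definition zero_poly_tensor :: "('a, 'b) poly_tensor" is 0 .

lift_definition plus_poly_tensor ::
    "('a, 'b) poly_tensor \<Rightarrow> ('a, 'b) poly_tensor \<Rightarrow> ('a, 'b) poly_tensor" is "(+)"
  by (metis add_diff_add tensor_relations_add)

lift_definition uminus_poly_tensor :: "('a, 'b) poly_tensor \<Rightarrow> ('a, 'b) poly_tensor" is uminus
  using tensor_relations_uminus by fastforce

lift_definition minus_poly_tensor ::
    "('a, 'b) poly_tensor \<Rightarrow> ('a, 'b) poly_tensor \<Rightarrow> ('a, 'b) poly_tensor" is "(-)"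
  by (metis (no_types, lifting) diff_diff_eq2 diff_add_eq add_diff_eq diff_diff_eq add.commute
      tensor_relations.diff)

instance
  by standard (transfer, simp add: tensor_relations.zero algebra_simps)+

end

lift_definition tscale :: "'a::comm_ring_1 \<Rightarrow> ('a, 'n) poly_tensor \<Rightarrow> ('a, 'n) poly_tensor"
  is "\<lambda>c. Poly_Mapping.map ((*) c)"
  by (metis map_mult_diff tensor_relations_scale)

lemma abs_poly_tensor_cases: obtains F where "X = abs_poly_tensor F"
  using Quotient3_abs_rep[OF Quotient3_poly_tensor] by metis

interpretation tscale: module tscale
proof
  fix a b :: 'a and x y :: "('a, 'b) poly_tensor"
  obtain F G where [simp]: "x = abs_poly_tensor F" "y = abs_poly_tensor G"
    by (metis abs_poly_tensor_cases)
  show "tscale a (x + y) = tscale a x + tscale a y"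
    by (auto simp: tscale.abs_eq plus_poly_tensor.abs_eq lookup_map_mult lookup_add algebra_simps
        intro!: arg_cong[where f = abs_poly_tensor] poly_mapping_eqI)
  show "tscale (a + b) x = tscale a x + tscale b x"
    by (auto simp: tscale.abs_eq plus_poly_tensor.abs_eq lookup_map_mult lookup_add algebra_simps
        intro!: arg_cong[where f = abs_poly_tensor] poly_mapping_eqI)
  show "tscale a (tscale b x) = tscale (a * b) x"
    by (auto simp: tscale.abs_eq lookup_map_mult algebra_simps
        intro!: arg_cong[where f = abs_poly_tensor] poly_mapping_eqI)
  show "tscale 1 x = x"
    by (auto simp: tscale.abs_eq lookup_map_mult
        intro!: arg_cong[where f = abs_poly_tensor] poly_mapping_eqI)
qed

definition ptensor :: "('n \<Rightarrow> 'a::comm_ring_1 poly) \<Rightarrow> ('a, 'n) poly_tensor" where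
  "ptensor f = abs_poly_tensor (Poly_Mapping.single f 1)"

definition multilinear_map ::
    "('a::comm_ring_1 \<Rightarrow> 'm::ab_group_add \<Rightarrow> 'm) \<Rightarrow> (('n \<Rightarrow> 'a poly) \<Rightarrow> 'm) \<Rightarrow> bool" where
  "multilinear_map s h \<longleftrightarrow>
     (\<forall>f i p q. h (f(i := p + q)) = h (f(i := p)) + h (f(i := q))) \<and>
     (\<forall>f i c p. h (f(i := smult c p)) = s c (h (f(i := p))))"

definition free_extend ::
    "('a::comm_ring_1 \<Rightarrow> 'm::ab_group_add \<Rightarrow> 'm) \<Rightarrow> ('x \<Rightarrow> 'm) \<Rightarrow> ('x \<Rightarrow>\<^sub>0 'a) \<Rightarrow> 'm" where
  "free_extend s h F = (\<Sum>x\<in>Poly_Mapping.keys F. s (Poly_Mapping.lookup F x) (h x))"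

text \<open>
  For a multilinear \<open>h\<close> the value of \<open>tlift\<close> does not depend on the chosen representative: it is
  the unique linear map extending \<open>h\<close>, see \<open>tlift_unique\<close> below.
\<close>

definition tlift ::
    "('a::comm_ring_1 \<Rightarrow> 'm::ab_group_add \<Rightarrow> 'm) \<Rightarrow> (('n \<Rightarrow> 'a poly) \<Rightarrow> 'm)
       \<Rightarrow> ('a, 'n) poly_tensor \<Rightarrow> 'm" where
  "tlift s h X = free_extend s h (rep_poly_tensor X)"

context module
begin

lemma free_extend_superset:
  assumes "finite S" "Poly_Mapping.keys F \<subseteq> S"
  shows "free_extend scale h F = (\<Sum>x\<in>S. scale (Poly_Mapping.lookup F x) (h x))"
  unfolding free_extend_def
  by (rule sum.mono_neutral_left) (use assms in \<open>auto simp: in_keys_iff\<close>)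

lemma free_extend_diff:
  "free_extend scale h (F - G) = free_extend scale h F - free_extend scale h G"
proof -
  let ?S = "Poly_Mapping.keys F \<union> Poly_Mapping.keys G"
  have "Poly_Mapping.keys (F - G) \<subseteq> ?S" by (rule keys_diff)
  then show ?thesis
    by (simp add: free_extend_superset[of ?S] lookup_minus scale_left_diff_distrib sum_subtractf)
qed

lemma free_extend_single: "free_extend scale h (Poly_Mapping.single x c) = scale c (h x)"
  by (subst free_extend_superset[of "{x}"]) auto

lemma free_extend_scale:
  "free_extend scale h (Poly_Mapping.map ((*) c) F) = scale c (free_extend scale h F)"
proof -
  have "Poly_Mapping.keys (Poly_Mapping.map ((*) c) F) \<subseteq> Poly_Mapping.keys F"
    by (auto simp: in_keys_iff lookup_map_mult)
  then show ?thesis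
    by (simp add: free_extend_superset[of "Poly_Mapping.keys F"] lookup_map_mult scale_sum_right)
qed

lemma free_extend_relations:
  assumes "multilinear_map scale h" "F \<in> tensor_relations"
  shows "free_extend scale h F = 0"
  using assms(2)
proof induction
  case zero
  show ?case by (simp add: free_extend_def)
qed (use assms(1) in \<open>simp_all add: free_extend_diff free_extend_single multilinear_map_def
      scale_right_distrib mult.commute\<close>)

lemma tlift_abs:
  assumes "multilinear_map scale h"
  shows "tlift scale h (abs_poly_tensor F) = free_extend scale h F"
proof -
  have "rep_poly_tensor (abs_poly_tensor F) - F \<in> tensor_relations"
    by (rule rep_abs_rsp_left[OF Quotient3_poly_tensor]) (simp add: tensor_relations.zero)
  then show ?thesis
    using free_extend_relations[OF assms] by (fastforce simp: free_extend_diff tlift_def)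
qed

end

lemma ptensor_multilinear: "multilinear_map tscale ptensor"
  unfolding multilinear_map_def
proof (intro conjI allI)
  show "ptensor (f(i := p + q)) = ptensor (f(i := p)) + ptensor (f(i := q))"
    for f :: "'b \<Rightarrow> 'a poly" and i p q
    unfolding ptensor_def plus_poly_tensor.abs_eq poly_tensor.abs_eq_iff
    by (metis diff_diff_eq tensor_relations.add)
  show "ptensor (f(i := smult c p)) = tscale c (ptensor (f(i := p)))"
    for f :: "'b \<Rightarrow> 'a poly" and i c p
    unfolding ptensor_def tscale.abs_eq poly_tensor.abs_eq_iff
    using tensor_relations.smult[of f i c p 1] by simp
qed

lemma ptensor_upd_add: "ptensor (f(i := p + q)) = ptensor (f(i := p)) + ptensor (f(i := q))"
  by (rule ptensor_multilinear[unfolded multilinear_map_def, THEN conjunct1, rule_format])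

lemma ptensor_upd_smult: "ptensor (f(i := smult c p)) = tscale c (ptensor (f(i := p)))"
  by (rule ptensor_multilinear[unfolded multilinear_map_def, THEN conjunct2, rule_format])

text \<open>The universal property of the tensor power.\<close>

context module
begin

lemma tlift_ptensor: "multilinear_map scale h \<Longrightarrow> tlift scale h (ptensor f) = h f"
  by (simp add: ptensor_def tlift_abs free_extend_single)

lemma tlift_module_hom:
  assumes "multilinear_map scale h"
  shows "module_hom tscale scale (tlift scale h)"
proof
  show "tlift scale h (X + Y) = tlift scale h X + tlift scale h Y" for X Y
  proof -
    obtain F G where "X = abs_poly_tensor F" "Y = abs_poly_tensor G"
      by (metis abs_poly_tensor_cases)
    moreover have "free_extend scale h (F + G) = free_extend scale h F + free_extend scale h G"
      using free_extend_diff[of h "F + G" G] by simp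
    ultimately show ?thesis
      by (simp add: plus_poly_tensor.abs_eq tlift_abs[OF assms])
  qed
  show "tlift scale h (tscale c X) = scale c (tlift scale h X)" for c X
    by (cases X rule: abs_poly_tensor_cases)
       (simp add: tscale.abs_eq tlift_abs[OF assms] free_extend_scale)
qed

end

lemma poly_tensor_induct [case_names zero add]:
  assumes "P 0" and "\<And>c f X. P X \<Longrightarrow> P (tscale c (ptensor f) + X)"
  shows "P X"
proof -
  have "P (abs_poly_tensor F)" for F
  proof (induction F rule: update_induct)
    case const
    show ?case using assms(1) by (simp add: zero_poly_tensor.abs_eq)
  next
    case (update F k v)
    have "Poly_Mapping.update k v F = Poly_Mapping.single k v + F"
      using update(1)
      by (intro poly_mapping_eqI) (auto simp: lookup_update lookup_add lookup_single when_def in_keys_iff)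
    then have "abs_poly_tensor (Poly_Mapping.update k v F)
                 = tscale v (ptensor k) + abs_poly_tensor F"
      by (simp add: ptensor_def tscale.abs_eq plus_poly_tensor.abs_eq)
    then show ?case using assms(2) update by metis
  qed
  then show ?thesis by (metis abs_poly_tensor_cases)
qed

lemma poly_tensor_hom_eqI:
  assumes "module_hom tscale s F" "module_hom tscale s G" "\<And>f. F (ptensor f) = G (ptensor f)"
  shows "F X = G X"
proof -
  interpret F: module_hom tscale s F by fact
  interpret G: module_hom tscale s G by fact
  show ?thesis
    by (induction X rule: poly_tensor_induct)
       (simp_all add: F.add F.scale F.zero G.add G.scale G.zero assms(3))
qed

lemma (in module) tlift_unique:
  assumes "multilinear_map scale h" "module_hom tscale scale F" "\<And>f. F (ptensor f) = h f"
  shows "F = tlift scale h"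
  by (rule ext, rule poly_tensor_hom_eqI[OF assms(2) tlift_module_hom[OF assms(1)]])
     (simp add: assms tlift_ptensor)

lemma tlift_tscale_add:
  "multilinear_map tscale h \<Longrightarrow> tlift tscale h (X + Y) = tlift tscale h X + tlift tscale h Y"
  and tlift_tscale_scale:
  "multilinear_map tscale h \<Longrightarrow> tlift tscale h (tscale c X) = tscale c (tlift tscale h X)"
  and tlift_tscale_zero:
  "multilinear_map tscale h \<Longrightarrow> tlift tscale h 0 = 0"
proof -
  assume "multilinear_map tscale h"
  then interpret h: module_hom tscale tscale "tlift tscale h" by (rule tscale.tlift_module_hom)
  show "tlift tscale h (X + Y) = tlift tscale h X + tlift tscale h Y"
    "tlift tscale h (tscale c X) = tscale c (tlift tscale h X)" "tlift tscale h 0 = 0"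
    by (simp_all add: h.add h.scale)
qed

section \<open>The algebra structure\<close>

instantiation poly_tensor :: (comm_ring_1, finite) comm_ring_1
begin

definition one_poly_tensor :: "('a, 'b) poly_tensor" where
  "1 = ptensor (\<lambda>i. 1)"

definition times_poly_tensor ::
    "('a, 'b) poly_tensor \<Rightarrow> ('a, 'b) poly_tensor \<Rightarrow> ('a, 'b) poly_tensor" where
  "X * Y = tlift tscale (\<lambda>f. tlift tscale (\<lambda>g. ptensor (\<lambda>i. f i * g i)) Y) X"

lemma ptensor_mult_upd:
  "ptensor (\<lambda>i. (f(j := p)) i * g i) = ptensor ((\<lambda>i. f i * g i)(j := p * g j))"
  "ptensor (\<lambda>i. f i * (g(j := p)) i) = ptensor ((\<lambda>i. f i * g i)(j := f j * p))"
  by (auto intro!: arg_cong[where f = ptensor])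

lemma times_inner_multilinear: "multilinear_map tscale (\<lambda>g. ptensor (\<lambda>i. f i * g i))"
  unfolding multilinear_map_def
  by (simp only: ptensor_mult_upd distrib_left mult_smult_right ptensor_upd_add ptensor_upd_smult)
     simp

lemma times_outer_multilinear:
  "multilinear_map tscale (\<lambda>f. tlift tscale (\<lambda>g. ptensor (\<lambda>i. f i * g i)) Y)"
proof (induction Y rule: poly_tensor_induct)
  case zero
  show ?case
    by (simp add: multilinear_map_def tlift_tscale_zero[OF times_inner_multilinear])
next
  case (add c f X)
  have f: "multilinear_map tscale (\<lambda>g. ptensor (\<lambda>i. g i * f i))"
    using times_inner_multilinear[of f] by (simp only: mult.commute)
  have "tlift tscale (\<lambda>g. ptensor (\<lambda>i. h i * g i)) (tscale c (ptensor f) + X)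
          = tscale c (ptensor (\<lambda>i. h i * f i)) + tlift tscale (\<lambda>g. ptensor (\<lambda>i. h i * g i)) X" for h
    by (simp only: tlift_tscale_add[OF times_inner_multilinear]
        tlift_tscale_scale[OF times_inner_multilinear] tscale.tlift_ptensor[OF times_inner_multilinear])
  then show ?case
    using add f unfolding multilinear_map_def
    by (simp only: tscale.scale_right_distrib tscale.scale_left_commute[of c] add.assoc add.left_commute
        simp_thms)
qed

lemma ptensor_times_left:
  "ptensor f * Y = tlift tscale (\<lambda>g. ptensor (\<lambda>i. f i * g i)) Y"
  unfolding times_poly_tensor_def by (rule tscale.tlift_ptensor[OF times_outer_multilinear])

lemma ptensor_times: "ptensor f * ptensor g = ptensor (\<lambda>i. f i * g i)"
  unfolding ptensor_times_left by (rule tscale.tlift_ptensor[OF times_inner_multilinear])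

lemma ptensor_times_simps:
  "ptensor f * (X + Y) = ptensor f * X + ptensor f * Y"
  "ptensor f * tscale c X = tscale c (ptensor f * X)" "ptensor f * 0 = 0"
  for X Y :: "('a, 'b) poly_tensor"
  unfolding ptensor_times_left
  by (simp_all add: tlift_tscale_add tlift_tscale_scale tlift_tscale_zero times_inner_multilinear)

lemma tensor_times_simps:
  "(X + Y) * Z = X * Z + Y * Z" "tscale c X * Z = tscale c (X * Z)" "0 * Z = 0"
  for X Y Z :: "('a, 'b) poly_tensor"
  by (simp_all add: times_poly_tensor_def tlift_tscale_add tlift_tscale_scale tlift_tscale_zero
      times_outer_multilinear)

lemma tensor_times_comm: "X * Y = Y * X" for X Y :: "('a, 'b) poly_tensor"
proof (induction X rule: poly_tensor_induct)
  case zero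
  have "Y * 0 = 0"
    by (induction Y rule: poly_tensor_induct) (simp_all add: tensor_times_simps ptensor_times_simps)
  then show ?case by (simp add: tensor_times_simps)
next
  case (add c f X)
  have "Y * (tscale c (ptensor f) + X) = tscale c (Y * ptensor f) + Y * X"
    by (induction Y rule: poly_tensor_induct)
       (simp_all add: tensor_times_simps ptensor_times_simps tscale.scale_right_distrib mult.commute)
  moreover have "Y * ptensor f = ptensor f * Y"
    by (induction Y rule: poly_tensor_induct)
       (simp_all add: tensor_times_simps ptensor_times_simps ptensor_times mult.commute)
  ultimately show ?case using add by (simp add: tensor_times_simps)
qed

lemma tensor_times_assoc: "(X * Y) * Z = X * (Y * Z)" for X Y Z :: "('a, 'b) poly_tensor"
proof (induction X rule: poly_tensor_induct)
  case (add c f X)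
  have "(ptensor f * Y) * Z = ptensor f * (Y * Z)"
  proof (induction Y rule: poly_tensor_induct)
    case (add d g Y)
    have "ptensor (\<lambda>i. f i * g i) * Z = ptensor f * (ptensor g * Z)"
      by (induction Z rule: poly_tensor_induct)
         (simp_all add: ptensor_times_simps ptensor_times mult.assoc)
    with add show ?case
      by (simp add: tensor_times_simps ptensor_times_simps ptensor_times)
  qed (simp add: tensor_times_simps ptensor_times_simps)
  with add show ?case by (simp add: tensor_times_simps)
qed (simp add: tensor_times_simps)

lemma tensor_one_neq_zero: "(0::('a, 'b) poly_tensor) \<noteq> 1"
proof
  assume zero_eq_one: "(0::('a, 'b) poly_tensor) = 1"
  interpret R: module "(*) :: 'a \<Rightarrow> 'a \<Rightarrow> 'a"
    by standard (simp_all add: algebra_simps)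
  define h where "h f = (\<Prod>i\<in>UNIV. poly (f i) 0)" for f :: "'b \<Rightarrow> 'a poly"
  have h_upd: "h (f(i := p)) = poly p 0 * (\<Prod>j\<in>UNIV - {i}. poly (f j) 0)" for f i p
    unfolding h_def by (subst prod.remove[of UNIV i]) (auto intro!: prod.cong)
  have h: "multilinear_map (*) h"
    unfolding multilinear_map_def h_upd by (simp only: poly_add poly_smult distrib_right mult.assoc simp_thms)
  interpret H: module_hom tscale "(*)" "tlift (*) h"
    by (rule R.tlift_module_hom[OF h])
  have "tlift (*) h (1::('a, 'b) poly_tensor) = 1"
    unfolding one_poly_tensor_def by (simp add: R.tlift_ptensor[OF h] h_def)
  with zero_eq_one H.zero show False by simp
qed

instance
proof
  fix X Y Z :: "('a, 'b) poly_tensor"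
  show "X * Y * Z = X * (Y * Z)" by (rule tensor_times_assoc)
  show "X * Y = Y * X" by (rule tensor_times_comm)
  show "(X + Y) * Z = X * Z + Y * Z" by (rule tensor_times_simps)
  show "1 * X = X"
    by (induction X rule: poly_tensor_induct)
       (simp_all add: one_poly_tensor_def ptensor_times_simps ptensor_times)
  show "(0::('a, 'b) poly_tensor) \<noteq> 1" by (rule tensor_one_neq_zero)
qed

end

section \<open>The action of the symmetric group\<close>

definition tperm :: "('n \<Rightarrow> 'n) \<Rightarrow> ('a::comm_ring_1, 'n) poly_tensor \<Rightarrow> ('a, 'n) poly_tensor" where
  "tperm \<sigma> = tlift tscale (\<lambda>f. ptensor (\<lambda>i. f (inv \<sigma> i)))"

lemma tperm_multilinear:
  fixes \<sigma> :: "'n \<Rightarrow> 'n"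
  assumes "bij \<sigma>"
  shows "multilinear_map tscale (\<lambda>f. ptensor (\<lambda>i. f (inv \<sigma> i) :: 'a::comm_ring_1 poly))"
proof -
  have "(\<lambda>k. (f(i := p)) (inv \<sigma> k)) = (\<lambda>k. f (inv \<sigma> k))(\<sigma> i := p)" 
    for f :: "'n \<Rightarrow> 'a poly" and i p
    using assms by (auto simp: fun_eq_iff bij_is_inj bij_is_surj surj_f_inv_f)
  then show ?thesis
    by (simp add: multilinear_map_def ptensor_upd_add ptensor_upd_smult del: fun_upd_apply)
qed

lemma tperm_ptensor: "bij \<sigma> \<Longrightarrow> tperm \<sigma> (ptensor f) = ptensor (\<lambda>i. f (inv \<sigma> i))"
  by (simp add: tperm_def tscale.tlift_ptensor tperm_multilinear)

definition hom_action ::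
    "('n \<Rightarrow> 'n) \<Rightarrow> (('a::comm_ring_1, 'n) poly_tensor \<Rightarrow> ('a, 'n) poly_tensor)
       \<Rightarrow> ('a, 'n) poly_tensor \<Rightarrow> ('a, 'n) poly_tensor" where
  "hom_action \<sigma> \<phi> = tperm \<sigma> \<circ> \<phi> \<circ> tperm (inv \<sigma>)"

text \<open>The subgroup of permutations generated by the cycle \<open>i \<mapsto> i + 1\<close>.\<close>

definition cyclic_perms :: "('n::comm_ring_1 \<Rightarrow> 'n) set" where
  "cyclic_perms = range (\<lambda>k. (\<lambda>i. i + 1) ^^ k)"

section \<open>Double Poisson structures\<close>

definition tensor2 :: "'a::comm_ring_1 poly \<Rightarrow> 'a poly \<Rightarrow> ('a, 2) poly_tensor" (infix "\<otimes>" 75) where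
  "a \<otimes> b = ptensor (\<lambda>i. if i = 1 then a else b)"

definition tensor3 ::
    "'a::comm_ring_1 poly \<Rightarrow> 'a poly \<Rightarrow> 'a poly \<Rightarrow> ('a, 3) poly_tensor" where
  "tensor3 a b c = ptensor (\<lambda>i. if i = 1 then a else if i = 2 then b else c)"

lemma exhaust_type_2: "x = 1 \<or> x = 2" for x :: 2
proof (induction x)
  case (of_int z)
  then have "z = 0 \<or> z = 1" by fastforce
  then show ?case by auto
qed

lemma exhaust_type_3: "x = 1 \<or> x = 2 \<or> x = 3" for x :: 3
proof (induction x)
  case (of_int z)
  then have "z = 0 \<or> z = 1 \<or> z = 2" by fastforce
  then show ?case by auto
qed

lemma ptensor_eq_tensor2: "ptensor f = f 1 \<otimes> f 2"
proof -
  have "f = (\<lambda>i. if i = 1 then f 1 else f 2)"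
    using exhaust_type_2 by (metis (full_types))
  then show ?thesis unfolding tensor2_def by simp
qed

lemma ptensor_eq_tensor3: "ptensor f = tensor3 (f 1) (f 2) (f 3)"
proof -
  have "f = (\<lambda>i. if i = 1 then f 1 else if i = 2 then f 2 else f 3)"
    using exhaust_type_3 by (metis (full_types))
  then show ?thesis unfolding tensor3_def by simp
qed

lemma tensor2_linear:
  "(a + a') \<otimes> b = a \<otimes> b + a' \<otimes> b" "smult c a \<otimes> b = tscale c (a \<otimes> b)"
  "a \<otimes> (b + b') = a \<otimes> b + a \<otimes> b'" "a \<otimes> smult c b = tscale c (a \<otimes> b)"
proof -
  let ?f = "\<lambda>i::2. if i = 1 then a else b"
  show "(a + a') \<otimes> b = a \<otimes> b + a' \<otimes> b" "smult c a \<otimes> b = tscale c (a \<otimes> b)"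
    using ptensor_upd_add[of ?f 1 a a'] ptensor_upd_smult[of ?f 1 c a]
    by (simp_all add: ptensor_eq_tensor2)
  show "a \<otimes> (b + b') = a \<otimes> b + a \<otimes> b'" "a \<otimes> smult c b = tscale c (a \<otimes> b)"
    using ptensor_upd_add[of ?f 2 b b'] ptensor_upd_smult[of ?f 2 c b]
    by (simp_all add: ptensor_eq_tensor2)
qed

lemma tensor3_linear:
  "tensor3 (a + a') b c = tensor3 a b c + tensor3 a' b c"
  "tensor3 (smult r a) b c = tscale r (tensor3 a b c)"
  "tensor3 a (b + b') c = tensor3 a b c + tensor3 a b' c"
  "tensor3 a (smult r b) c = tscale r (tensor3 a b c)"
  "tensor3 a b (c + c') = tensor3 a b c + tensor3 a b c'"
  "tensor3 a b (smult r c) = tscale r (tensor3 a b c)"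
proof -
  let ?f = "\<lambda>i::3. if i = 1 then a else if i = 2 then b else c"
  show "tensor3 (a + a') b c = tensor3 a b c + tensor3 a' b c"
    "tensor3 (smult r a) b c = tscale r (tensor3 a b c)"
    using ptensor_upd_add[of ?f 1 a a'] ptensor_upd_smult[of ?f 1 r a]
    by (simp_all add: ptensor_eq_tensor3)
  show "tensor3 a (b + b') c = tensor3 a b c + tensor3 a b' c"
    "tensor3 a (smult r b) c = tscale r (tensor3 a b c)"
    using ptensor_upd_add[of ?f 2 b b'] ptensor_upd_smult[of ?f 2 r b]
    by (simp_all add: ptensor_eq_tensor3)
  show "tensor3 a b (c + c') = tensor3 a b c + tensor3 a b c'"
    "tensor3 a b (smult r c) = tscale r (tensor3 a b c)"
    using ptensor_upd_add[of ?f 3 c c'] ptensor_upd_smult[of ?f 3 r c]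
    by (simp_all add: ptensor_eq_tensor3)
qed

text \<open>The isomorphisms from \<open>A\<^sup>\<otimes>\<^sup>2 \<otimes> A\<close> and \<open>A \<otimes> A\<^sup>\<otimes>\<^sup>2\<close> to \<open>A\<^sup>\<otimes>\<^sup>3\<close>, as bilinear maps.\<close>

definition append_factor ::
    "('a::comm_ring_1, 2) poly_tensor \<Rightarrow> 'a poly \<Rightarrow> ('a, 3) poly_tensor" where
  "append_factor X c = tlift tscale (\<lambda>f. tensor3 (f 1) (f 2) c) X"

definition prepend_factor ::
    "'a::comm_ring_1 poly \<Rightarrow> ('a, 2) poly_tensor \<Rightarrow> ('a, 3) poly_tensor" where
  "prepend_factor a X = tlift tscale (\<lambda>f. tensor3 a (f 1) (f 2)) X"

lemma multilinear_map_2I: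
  assumes "\<And>f. h f = B (f (1::2)) (f 2)"
    and "\<And>a a' b. B (a + a') b = B a b + B a' b" "\<And>c a b. B (smult c a) b = s c (B a b)"
    and "\<And>a b b'. B a (b + b') = B a b + B a b'" "\<And>c a b. B a (smult c b) = s c (B a b)"
  shows "multilinear_map s h"
  unfolding multilinear_map_def
proof (intro conjI allI)
  show "h (f(i := p + q)) = h (f(i := p)) + h (f(i := q))" for f i p q
    using exhaust_type_2[of i] by (elim disjE) (simp_all add: assms)
  show "h (f(i := smult c p)) = s c (h (f(i := p)))" for f i c p
    using exhaust_type_2[of i] by (elim disjE) (simp_all add: assms)
qed

lemma multilinear_map_3I:
  assumes "\<And>f. h f = B (f (1::3)) (f 2) (f 3)"
    and "\<And>a a' b c. B (a + a') b c = B a b c + B a' b c"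
    and "\<And>r a b c. B (smult r a) b c = s r (B a b c)"
    and "\<And>a b b' c. B a (b + b') c = B a b c + B a b' c"
    and "\<And>r a b c. B a (smult r b) c = s r (B a b c)"
    and "\<And>a b c c'. B a b (c + c') = B a b c + B a b c'"
    and "\<And>r a b c. B a b (smult r c) = s r (B a b c)"
  shows "multilinear_map s h"
  unfolding multilinear_map_def
proof (intro conjI allI)
  show "h (f(i := p + q)) = h (f(i := p)) + h (f(i := q))" for f i p q
    using exhaust_type_3[of i] by (elim disjE) (simp_all add: assms)
  show "h (f(i := smult c p)) = s c (h (f(i := p)))" for f i c p
    using exhaust_type_3[of i] by (elim disjE) (simp_all add: assms)
qed

lemma append_factor_multilinear: "multilinear_map tscale (\<lambda>f. tensor3 (f (1::2)) (f 2) c)"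
  by (rule multilinear_map_2I[where B = "\<lambda>a b. tensor3 a b c"]) (simp_all add: tensor3_linear)

lemma prepend_factor_multilinear: "multilinear_map tscale (\<lambda>f. tensor3 a (f (1::2)) (f 2))"
  by (rule multilinear_map_2I[where B = "\<lambda>b c. tensor3 a b c"]) (simp_all add: tensor3_linear)

lemma append_factor_tensor2: "append_factor (a \<otimes> b) c = tensor3 a b c"
  using tscale.tlift_ptensor[OF append_factor_multilinear, of c "\<lambda>i. if i = 1 then a else b"]
  by (simp add: append_factor_def tensor2_def)

lemma prepend_factor_tensor2: "prepend_factor a (b \<otimes> c) = tensor3 a b c"
  using tscale.tlift_ptensor[OF prepend_factor_multilinear, of a "\<lambda>i. if i = 1 then b else c"]
  by (simp add: prepend_factor_def tensor2_def)

lemma append_factor_linear: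
  "append_factor (X + Y) c = append_factor X c + append_factor Y c"
  "append_factor (tscale r X) c = tscale r (append_factor X c)"
  "append_factor X (c + c') = append_factor X c + append_factor X c'"
  "append_factor X (smult r c) = tscale r (append_factor X c)"
proof -
  show lin: "append_factor (X + Y) c = append_factor X c + append_factor Y c"
    "append_factor (tscale r X) c = tscale r (append_factor X c)" for X Y c r
    by (simp_all add: append_factor_def tlift_tscale_add tlift_tscale_scale append_factor_multilinear)
  have zero: "append_factor 0 c = 0" for c :: "'a poly"
    using lin(1)[of 0 0 c] by simp
  show "append_factor X (c + c') = append_factor X c + append_factor X c'"
    by (induction X rule: poly_tensor_induct)
       (simp_all add: zero lin ptensor_eq_tensor2 append_factor_tensor2 tensor3_linear
         tscale.scale_right_distrib)
  show "append_factor X (smult r c) = tscale r (append_factor X c)"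
    by (induction X rule: poly_tensor_induct)
       (simp_all add: zero lin ptensor_eq_tensor2 append_factor_tensor2 tensor3_linear
         tscale.scale_right_distrib mult.commute)
qed

lemma prepend_factor_linear:
  "prepend_factor a (X + Y) = prepend_factor a X + prepend_factor a Y"
  "prepend_factor a (tscale r X) = tscale r (prepend_factor a X)"
  "prepend_factor (a + a') X = prepend_factor a X + prepend_factor a' X"
  "prepend_factor (smult r a) X = tscale r (prepend_factor a X)"
proof -
  show lin: "prepend_factor a (X + Y) = prepend_factor a X + prepend_factor a Y"
    "prepend_factor a (tscale r X) = tscale r (prepend_factor a X)" for X Y a r
    by (simp_all add: prepend_factor_def tlift_tscale_add tlift_tscale_scale
        prepend_factor_multilinear)
  have zero: "prepend_factor a 0 = 0" for a :: "'a poly"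
    using lin(1)[of a 0 0] by simp
  show "prepend_factor (a + a') X = prepend_factor a X + prepend_factor a' X"
    by (induction X rule: poly_tensor_induct)
       (simp_all add: zero lin ptensor_eq_tensor2 prepend_factor_tensor2 tensor3_linear
         tscale.scale_right_distrib)
  show "prepend_factor (smult r a) X = tscale r (prepend_factor a X)"
    by (induction X rule: poly_tensor_induct)
       (simp_all add: zero lin ptensor_eq_tensor2 prepend_factor_tensor2 tensor3_linear
         tscale.scale_right_distrib mult.commute)
qed

text \<open>The maps \<open>\<phi> \<otimes> 1\<close> and \<open>1 \<otimes> \<phi>\<close> for a linear \<open>\<phi>\<close>.\<close>

definition hom_tensor_id ::
    "(('a::comm_ring_1, 2) poly_tensor \<Rightarrow> ('a, 2) poly_tensor)
       \<Rightarrow> ('a, 3) poly_tensor \<Rightarrow> ('a, 3) poly_tensor" where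
  "hom_tensor_id \<phi> = tlift tscale (\<lambda>f. append_factor (\<phi> (f 1 \<otimes> f 2)) (f 3))"

definition id_tensor_hom ::
    "(('a::comm_ring_1, 2) poly_tensor \<Rightarrow> ('a, 2) poly_tensor)
       \<Rightarrow> ('a, 3) poly_tensor \<Rightarrow> ('a, 3) poly_tensor" where
  "id_tensor_hom \<phi> = tlift tscale (\<lambda>f. prepend_factor (f 1) (\<phi> (f 2 \<otimes> f 3)))"

lemma hom_tensor_id_tensor3:
  assumes "module_hom tscale tscale \<phi>"
  shows "hom_tensor_id \<phi> (tensor3 a b c) = append_factor (\<phi> (a \<otimes> b)) c"
proof -
  interpret \<phi>: module_hom tscale tscale \<phi> by fact
  have "multilinear_map tscale (\<lambda>f. append_factor (\<phi> (f 1 \<otimes> f 2)) (f (3::3)))"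
    by (rule multilinear_map_3I[where B = "\<lambda>a b c. append_factor (\<phi> (a \<otimes> b)) c"])
       (simp_all add: tensor2_linear \<phi>.add \<phi>.scale append_factor_linear)
  from tscale.tlift_ptensor[OF this, of "\<lambda>i. if i = 1 then a else if i = 2 then b else c"]
  show ?thesis by (simp add: hom_tensor_id_def tensor3_def)
qed

lemma id_tensor_hom_tensor3:
  assumes "module_hom tscale tscale \<phi>"
  shows "id_tensor_hom \<phi> (tensor3 a b c) = prepend_factor a (\<phi> (b \<otimes> c))"
proof -
  interpret \<phi>: module_hom tscale tscale \<phi> by fact
  have "multilinear_map tscale (\<lambda>f. prepend_factor (f 1) (\<phi> (f 2 \<otimes> f (3::3))))"
    by (rule multilinear_map_3I[where B = "\<lambda>a b c. prepend_factor a (\<phi> (b \<otimes> c))"])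
       (simp_all add: tensor2_linear \<phi>.add \<phi>.scale prepend_factor_linear)
  from tscale.tlift_ptensor[OF this, of "\<lambda>i. if i = 1 then a else if i = 2 then b else c"]
  show ?thesis by (simp add: id_tensor_hom_def tensor3_def)
qed

definition derivation_last ::
    "(('a::comm_ring_1, 2) poly_tensor \<Rightarrow> ('a, 2) poly_tensor) \<Rightarrow> bool" where
  "derivation_last \<phi> \<longleftrightarrow>
     (\<forall>a b c. \<phi> (c \<otimes> (a * b)) = (a \<otimes> 1) * \<phi> (c \<otimes> b) + \<phi> (c \<otimes> a) * (1 \<otimes> b))"

definition double_bracket ::
    "(('a::comm_ring_1, 2) poly_tensor \<Rightarrow> ('a, 2) poly_tensor) \<Rightarrow> bool" where
  "double_bracket \<phi> \<longleftrightarrow>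
     module_hom tscale tscale \<phi> \<and> derivation_last \<phi> \<and>
     (let \<tau> = tperm (transpose 1 2) in \<forall>X. (\<tau> \<circ> \<phi> \<circ> \<tau>) X = - \<phi> X)"

definition double_jacobiator ::
    "(('a::comm_ring_1, 2) poly_tensor \<Rightarrow> ('a, 2) poly_tensor)
       \<Rightarrow> ('a, 3) poly_tensor \<Rightarrow> ('a, 3) poly_tensor" where
  "double_jacobiator \<phi> X =
     (\<Sum>\<sigma>\<in>cyclic_perms. hom_action \<sigma> (hom_tensor_id \<phi> \<circ> id_tensor_hom \<phi>) X)"

definition double_poisson ::
    "(('a::comm_ring_1, 2) poly_tensor \<Rightarrow> ('a, 2) poly_tensor) \<Rightarrow> bool" where
  "double_poisson \<phi> \<longleftrightarrow> double_bracket \<phi> \<and> (\<forall>X. double_jacobiator \<phi> X = 0)"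

text \<open>
  If \<open>2c = 0\<close> then \<open>c (1 \<otimes> 1)\<close> is antisymmetric, and the double bracket with this value at
  \<open>t \<otimes> t\<close> has zero Jacobiator; over a ring with 2-torsion the antisymmetric double brackets
  therefore include further, homogeneous, double Poisson structures.
\<close>

text \<open>The homogeneous components for the grading with \<open>t\<close> in degree 1; those of negative degree are 0.\<close>

definition tensor_grade :: "int \<Rightarrow> ('a::comm_ring_1, 'n::finite) poly_tensor set" where
  "tensor_grade d = module.span tscale
     {ptensor f | f k. (\<Sum>i\<in>UNIV. int (k i)) = d \<and> (\<forall>i. f i \<in> range (\<lambda>c. monom c (k i)))}"

definition homogeneous_map ::
    "(('a::comm_ring_1, 'n::finite) poly_tensor \<Rightarrow> ('a, 'n) poly_tensor) \<Rightarrow> bool" where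
  "homogeneous_map \<phi> \<longleftrightarrow> (\<exists>d. \<forall>n. \<phi> ` tensor_grade n \<subseteq> tensor_grade (n + d))"

abbreviation tvar :: "'a::comm_ring_1 poly" where
  "tvar \<equiv> monom 1 1"

text \<open>The double bracket determined by \<open>e\<close>, meaningful only if exactly one has this value at \<open>t \<otimes> t\<close>.\<close>

definition bracket_of ::
    "('a::comm_ring_1, 2) poly_tensor \<Rightarrow> ('a, 2) poly_tensor \<Rightarrow> ('a, 2) poly_tensor" where
  "bracket_of e = (THE \<phi>. double_bracket \<phi> \<and> \<phi> (tvar \<otimes> tvar) = e)"

definition bracket_value :: "'a::comm_ring_1 \<Rightarrow> 'a \<Rightarrow> 'a \<Rightarrow> ('a, 2) poly_tensor" where
  "bracket_value l m n =
     tscale l (tvar \<otimes> 1 - 1 \<otimes> tvar) + tscale m (tvar\<^sup>2 \<otimes> 1 - 1 \<otimes> tvar\<^sup>2) +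
     tscale n (tvar\<^sup>2 \<otimes> tvar - tvar \<otimes> tvar\<^sup>2)"

end

theory Submission
  imports Defs
begin

text \<open>
  Identify \<open>A \<otimes> A\<close> with \<open>R[x,y]\<close> and \<open>A \<otimes> A \<otimes> A\<close> with \<open>R[x,y,z]\<close>, and let
  \<open>\<Delta>a = (a(x) - a(y)) / (x - y)\<close> be the divided difference of \<open>a\<close>.  A derivation in the last
  argument is determined by its value at \<open>t\<close>, via multiplication by \<open>\<Delta>\<close>, and antisymmetry gives
  the same for the first argument.  Hence a double bracket maps \<open>a \<otimes> b\<close> to \<open>e \<Delta>a \<Delta>b\<close> with
  \<open>e\<close> its value at \<open>t \<otimes> t\<close>, and double brackets correspond to antisymmetric polynomials
  \<open>e(x,y)\<close> (\<open>double_bracket_value\<close>, \<open>bracket_map_double_bracket\<close>).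

  Let \<open>e = (x - y) s\<close> with \<open>s\<close> symmetric; every antisymmetric \<open>e\<close> has this form if \<open>R\<close> has no
  2-torsion (\<open>antisymmetric_factorization\<close>).  Then the Jacobiator at \<open>a \<otimes> b \<otimes> c\<close> is
  \<open>J(s) \<Delta>a(x,y) \<Delta>b(y,z) \<Delta>c(x,z)\<close>, where
  \<open>J(s) = (y - z) s(x,y) s(x,z) - (x - z) s(x,y) s(y,z) + (x - y) s(y,z) s(x,z)\<close>
  (\<open>double_jacobiator_tensor3\<close>).  So the bracket is double Poisson exactly if \<open>J(s) = 0\<close>.

  For \<open>s = l + m (x + y) + n x y\<close> one computes \<open>J(s) = (m\<^sup>2 - l n) (x - y) (y - z) (x - z)\<close>, which
  decides the bracket with value \<open>bracket_value l m n\<close>.  Conversely, let \<open>J(s) = 0\<close> and suppose that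
  \<open>s\<close> has degree \<open>d \<ge> 2\<close> in \<open>x\<close>, with leading coefficient \<open>p(y)\<close>.  Only the first summand of
  \<open>J(s)\<close> reaches degree \<open>2d\<close> in \<open>x\<close>, so \<open>(y - z) p(y) p(z) = 0\<close>.  As \<open>y - z\<close> is not a zero
  divisor, the square of each coefficient of \<open>p\<close> vanishes, whence \<open>p = 0\<close>, a contradiction
  (\<open>degree_expand2_le_1\<close>).  A symmetric \<open>s\<close> of degree at most 1 in \<open>x\<close> is of the form above.

  For a homogeneous bracket only the terms of one degree survive in \<open>bracket_value l m n\<close>.  The
  coefficients \<open>l\<close>, \<open>m\<close>, \<open>n\<close> belong to the degrees 1, 2, 3, so \<open>l = 0\<close> or \<open>n = 0\<close>; then
  \<open>m\<^sup>2 = l n = 0\<close> gives \<open>m = 0\<close>.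
\<close>

section \<open>Computing in the tensor square and cube\<close>

text \<open>
  Otherwise the simplifier rewrites the variable \<open>monom 1 1\<close> to \<open>monom 1 (Suc 0)\<close>, and facts about
  it no longer match.
\<close>

declare One_nat_def [simp del]

lemma tensor2_mult: "(a \<otimes> b) * (c \<otimes> d) = (a * c) \<otimes> (b * d)"
  unfolding tensor2_def ptensor_times by (rule arg_cong[where f = ptensor]) auto

lemma tensor3_mult: "tensor3 a b c * tensor3 a' b' c' = tensor3 (a * a') (b * b') (c * c')"
  unfolding tensor3_def ptensor_times by (rule arg_cong[where f = ptensor]) auto

lemma tensor2_one: "1 \<otimes> 1 = 1"
  by (simp add: tensor2_def one_poly_tensor_def)

lemma tensor3_one: "tensor3 1 1 1 = 1"
  unfolding one_poly_tensor_def by (simp add: ptensor_eq_tensor3)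

lemma tscale_mult_left: "tscale c X * Y = tscale c (X * Y)"
  for X Y :: "('a::comm_ring_1, 'n::finite) poly_tensor"
  by (rule tensor_times_simps)

lemma tscale_mult_right: "X * tscale c Y = tscale c (X * Y)"
  for X Y :: "('a::comm_ring_1, 'n::finite) poly_tensor"
  by (metis mult.commute tscale_mult_left)

lemma tscale_conv_mult: "tscale c X = tscale c 1 * X"
  for X :: "('a::comm_ring_1, 'n::finite) poly_tensor"
  by (simp add: tscale_mult_left)

lemma tensor2_zero: "0 \<otimes> a = 0" "a \<otimes> 0 = 0"
  using tensor2_linear(1)[of 0 0 a] tensor2_linear(3)[of a 0 0] by simp_all

lemma tensor2_minus: "(- a) \<otimes> b = - (a \<otimes> b)" "a \<otimes> (- b) = - (a \<otimes> b)"
  using tensor2_linear(2)[of "- 1" a b] tensor2_linear(4)[of a "- 1" b]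
  by (simp_all add: tscale.scale_minus_left)

lemma const_tensor2: "[:c:] \<otimes> 1 = tscale c 1" "1 \<otimes> [:c:] = tscale c 1"
  using tensor2_linear(2)[of c 1 1] tensor2_linear(4)[of 1 c 1] by (simp_all add: tensor2_one)

lemma tensor2_pCons: "pCons c a \<otimes> 1 = tscale c 1 + (tvar \<otimes> 1) * (a \<otimes> 1)"
  "1 \<otimes> pCons c a = tscale c 1 + (1 \<otimes> tvar) * (1 \<otimes> a)"
proof -
  have "pCons c a = [:c:] + tvar * a" by (simp add: monom_altdef)
  then show "pCons c a \<otimes> 1 = tscale c 1 + (tvar \<otimes> 1) * (a \<otimes> 1)"
    "1 \<otimes> pCons c a = tscale c 1 + (1 \<otimes> tvar) * (1 \<otimes> a)"
    by (simp_all only: tensor2_linear const_tensor2 tensor2_mult mult_1)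
qed

text \<open>
  A linear map on the tensor power is a ring homomorphism once it respects products of pure tensors;
  all ring homomorphisms below are obtained in this way from the universal property.
\<close>

lemma tensor_hom_mult:
  fixes F :: "('a::comm_ring_1, 'n::finite) poly_tensor \<Rightarrow> 'm::comm_ring_1"
  assumes "module_hom tscale s F" "\<And>c x y. s c (x * y) = s c x * y"
    and "\<And>f g. F (ptensor f * ptensor g) = F (ptensor f) * F (ptensor g)"
  shows "F (X * Y) = F X * F Y"
proof -
  interpret F: module_hom tscale s F by fact
  have ptensor_left: "F (ptensor f * Y) = F (ptensor f) * F Y" for f
  proof (induction Y rule: poly_tensor_induct)
    case (add c g Y)
    have "F (ptensor f * (tscale c (ptensor g) + Y))
            = s c (F (ptensor f) * F (ptensor g)) + F (ptensor f) * F Y"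
      by (simp only: distrib_left ptensor_times_simps F.add F.scale assms(3) add)
    also have "s c (F (ptensor f) * F (ptensor g)) = F (ptensor f) * s c (F (ptensor g))"
      by (simp add: mult.commute[of "F (ptensor f)"] assms(2))
    finally show ?case by (simp only: F.add F.scale distrib_left)
  qed (simp add: F.zero)
  show ?thesis
    by (induction X rule: poly_tensor_induct)
       (simp_all only: distrib_right tscale_mult_left F.add F.scale F.zero ptensor_left
         assms(2) mult_zero_left)
qed

lemma tensor2_hom_eqI:
  assumes "module_hom tscale s F" "module_hom tscale s G" "\<And>a b. F (a \<otimes> b) = G (a \<otimes> b)"
  shows "F X = G X"
  by (rule poly_tensor_hom_eqI[OF assms(1,2)]) (simp only: ptensor_eq_tensor2 assms(3))

lemma tensor3_hom_eqI:
  assumes "module_hom tscale s F" "module_hom tscale s G"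
    and "\<And>a b c. F (tensor3 a b c) = G (tensor3 a b c)"
  shows "F X = G X"
  by (rule poly_tensor_hom_eqI[OF assms(1,2)]) (simp only: ptensor_eq_tensor3 assms(3))

section \<open>Expansion in powers of the first variable\<close>

text \<open>
  These are the isomorphisms of \<open>R[x,y]\<close> with \<open>R[y][x]\<close> and of \<open>R[x,y,z]\<close> with \<open>R[y,z][x]\<close>.
  They give access to coefficients and to the degree in \<open>x\<close>.
\<close>

definition expand2 :: "('a::comm_ring_1, 2) poly_tensor \<Rightarrow> 'a poly poly" where
  "expand2 = tlift (\<lambda>c. smult [:c:]) (\<lambda>f. smult (f 2) (map_poly (\<lambda>c. [:c:]) (f 1)))"

definition expand3 :: "('a::comm_ring_1, 3) poly_tensor \<Rightarrow> ('a, 2) poly_tensor poly" where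
  "expand3 = tlift (\<lambda>c. smult (tscale c 1))
     (\<lambda>f. smult (f 2 \<otimes> f 3) (map_poly (\<lambda>c. tscale c 1) (f 1)))"

lemma module_smult_const: "module (\<lambda>c. smult [:c::'a::comm_ring_1:])"
  by standard (simp_all add: poly_eq_iff algebra_simps)

lemma module_smult_tscale:
  "module (\<lambda>c::'a::comm_ring_1. smult (tscale c 1 :: ('a, 'n::finite) poly_tensor))"
  by standard (simp_all add: smult_add_right tscale_mult_left tscale.scale_left_distrib smult_add_left)

lemma expand2_multilinear:
  "multilinear_map (\<lambda>c. smult [:c:])
     (\<lambda>f. smult (f (2::2)) (map_poly (\<lambda>c::'a::comm_ring_1. [:c:]) (f 1)))"
  by (rule multilinear_map_2I[where B = "\<lambda>a b. smult b (map_poly (\<lambda>c. [:c:]) a)"])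
     (simp_all add: poly_eq_iff coeff_map_poly algebra_simps)

lemma expand3_multilinear:
  "multilinear_map (\<lambda>c. smult (tscale c 1))
     (\<lambda>f. smult (f 2 \<otimes> f (3::3)) (map_poly (\<lambda>c::'a::comm_ring_1. tscale c 1) (f 1)))"
  by (rule multilinear_map_3I[where B = "\<lambda>a b c. smult (b \<otimes> c) (map_poly (\<lambda>c. tscale c 1) a)"])
     (simp_all add: poly_eq_iff coeff_map_poly tscale.scale_left_distrib tensor2_linear
        tscale.scale_right_distrib ring_distribs tscale_mult_left tscale_mult_right mult.commute)

lemma expand2_hom: "module_hom tscale (\<lambda>c. smult [:c:]) expand2"
  unfolding expand2_def by (rule module.tlift_module_hom[OF module_smult_const expand2_multilinear])

lemma expand3_hom: "module_hom tscale (\<lambda>c. smult (tscale c 1)) expand3"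
  unfolding expand3_def by (rule module.tlift_module_hom[OF module_smult_tscale expand3_multilinear])

lemma expand2_tensor2: "expand2 (a \<otimes> b) = smult b (map_poly (\<lambda>c. [:c:]) a)"
  by (simp add: tensor2_def expand2_def module.tlift_ptensor[OF module_smult_const expand2_multilinear])

lemma expand3_tensor3: "expand3 (tensor3 a b c) = smult (b \<otimes> c) (map_poly (\<lambda>c. tscale c 1) a)"
  by (simp add: tensor3_def expand3_def module.tlift_ptensor[OF module_smult_tscale expand3_multilinear])

lemmas expand2_add = module_hom.add[OF expand2_hom]
  and expand2_diff = module_hom.diff[OF expand2_hom]
  and expand2_zero = module_hom.zero[OF expand2_hom]
  and expand2_scale = module_hom.scale[OF expand2_hom]
  and expand3_add = module_hom.add[OF expand3_hom]
  and expand3_diff = module_hom.diff[OF expand3_hom]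
  and expand3_zero = module_hom.zero[OF expand3_hom]
  and expand3_scale = module_hom.scale[OF expand3_hom]

lemma map_poly_const_mult:
  "map_poly (\<lambda>c. [:c::'a::comm_ring_1:]) (a * b)
     = map_poly (\<lambda>c. [:c:]) a * map_poly (\<lambda>c. [:c:]) b"
proof -
  have "[:sum f A:] = (\<Sum>i\<in>A. [:f i:])" for f :: "nat \<Rightarrow> 'a" and A
    unfolding monom_0[symmetric] by (rule monom_sum)
  then show ?thesis by (simp add: poly_eq_iff[of "map_poly _ _"] coeff_map_poly coeff_mult mult.commute)
qed

lemma expand2_mult: "expand2 (X * Y) = expand2 X * expand2 Y"
  by (rule tensor_hom_mult[OF expand2_hom])
     (simp_all add: ptensor_eq_tensor2 tensor2_mult expand2_tensor2 map_poly_const_mult mult_ac)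

lemma map_poly_tscale_mult:
  "map_poly (\<lambda>c. tscale c 1 :: ('a::comm_ring_1, 'n::finite) poly_tensor) (a * b)
     = map_poly (\<lambda>c. tscale c 1) a * map_poly (\<lambda>c. tscale c 1) b"
  by (simp add: poly_eq_iff coeff_map_poly coeff_mult tscale.scale_sum_left tscale_mult_left)

lemma expand3_mult: "expand3 (X * Y) = expand3 X * expand3 Y"
  by (rule tensor_hom_mult[OF expand3_hom])
     (simp_all add: ptensor_eq_tensor3 tensor3_mult expand3_tensor3 tscale_mult_left
       map_poly_tscale_mult mult_ac flip: tensor2_mult)

text \<open>
  Evaluating the expansion at \<open>x\<close> recovers the element, so \<open>expand2\<close> loses no information.
\<close>

lemma tensor2_expansion: "poly (map_poly (\<lambda>p. 1 \<otimes> p) (expand2 X)) (tvar \<otimes> 1) = X"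
proof -
  define h where "h P = poly (map_poly (\<lambda>p. 1 \<otimes> p) P) (tvar \<otimes> 1)" for P :: "'a poly poly"
  have h_add: "h (P + Q) = h P + h Q" for P Q
  proof -
    have "map_poly (\<lambda>p. 1 \<otimes> p) (P + Q) = map_poly (\<lambda>p. 1 \<otimes> p) P + map_poly (\<lambda>p. 1 \<otimes> p) Q"
      by (simp add: poly_eq_iff coeff_map_poly tensor2_zero tensor2_linear)
    then show ?thesis by (simp add: h_def)
  qed
  have h_smult: "h (smult q P) = (1 \<otimes> q) * h P" for q P
  proof -
    have "map_poly (\<lambda>p. 1 \<otimes> p) (smult q P) = smult (1 \<otimes> q) (map_poly (\<lambda>p. 1 \<otimes> p) P)"
      by (simp add: poly_eq_iff coeff_map_poly tensor2_zero tensor2_mult)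
    then show ?thesis by (simp add: h_def)
  qed
  have h_const: "h (map_poly (\<lambda>c. [:c:]) a) = a \<otimes> 1" for a
  proof (induction a)
    case 0
    show ?case by (simp add: h_def tensor2_zero)
  next
    case (pCons c a)
    have "h (map_poly (\<lambda>c. [:c:]) (pCons c a)) = 1 \<otimes> [:c:] + (tvar \<otimes> 1) * (a \<otimes> 1)"
      using pCons by (simp add: h_def map_poly_pCons tensor2_zero)
    also have "\<dots> = pCons c a \<otimes> 1" by (simp only: tensor2_pCons const_tensor2 tensor2_zero mult_zero_right add_0_right)
    finally show ?case .
  qed
  show ?thesis
    unfolding h_def[symmetric]
  proof (rule tensor2_hom_eqI[where s = tscale and G = "\<lambda>X. X" and F = "\<lambda>X. h (expand2 X)"])
    have "h (smult [:c:] P) = tscale c (h P)" for c P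
      by (simp add: h_smult const_tensor2 flip: tscale_conv_mult)
    then show "module_hom tscale tscale (\<lambda>X. h (expand2 X))"
      by unfold_locales (simp_all add: expand2_add expand2_scale h_add)
    show "module_hom tscale tscale (\<lambda>X :: ('a, 2) poly_tensor. X)"
      by unfold_locales auto
  qed (simp add: expand2_tensor2 h_smult h_const tensor2_mult)
qed

lemma expand2_inject: "expand2 X = expand2 Y \<Longrightarrow> X = Y"
  by (metis tensor2_expansion)

lemma expand2_vars: "expand2 (tvar \<otimes> 1) = [:0, 1:]" "expand2 (1 \<otimes> tvar) = [:tvar:]"
  by (simp_all add: expand2_tensor2 map_poly_pCons monom_altdef)

text \<open>
  In \<open>R[y][x]\<close> the element \<open>x - y\<close> is monic, hence not a zero divisor over any \<open>R\<close>.
\<close>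

lemma variable_difference_regular:
  assumes "(tvar \<otimes> 1 - 1 \<otimes> tvar) * X = 0"
  shows "X = 0"
proof -
  have "[:- tvar, 1:] * expand2 X = 0"
    using arg_cong[OF assms, of expand2]
    by (simp add: expand2_mult expand2_diff expand2_vars expand2_zero del: mult_pCons_left One_nat_def)
  then have "0 + smult tvar (expand2 X) = pCons 0 (expand2 X)" by simp
  from synthetic_div_unique[OF this] show ?thesis
    using expand2_inject[of X 0] by (simp add: expand2_zero)
qed

section \<open>Divided differences\<close>

abbreviation (input) variable_difference :: "('a::comm_ring_1, 2) poly_tensor" where
  "variable_difference \<equiv> tvar \<otimes> 1 - 1 \<otimes> tvar"

text \<open>
  Defining the quotient by its characterization makes the linearity, Leibniz rule and symmetry
  of the divided difference identities in the ring, to be checked after multiplication by \<open>x - y\<close>.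
\<close>

definition divided_difference :: "'a::comm_ring_1 poly \<Rightarrow> ('a, 2) poly_tensor" where
  "divided_difference p = (THE D. variable_difference * D = p \<otimes> 1 - 1 \<otimes> p)"

lemma variable_difference_cancel:
  "variable_difference * X = variable_difference * Y \<longleftrightarrow> X = Y"
  using variable_difference_regular[of "X - Y"] by (auto simp: right_diff_distrib)

lemma variable_difference_mult_divided_difference:
  "variable_difference * divided_difference p = p \<otimes> 1 - 1 \<otimes> p"
proof -
  \<comment> \<open>Uses \<open>x a(x) - y a(y) = x (a(x) - a(y)) + (x - y) a(y)\<close>.\<close>
  have "\<exists>D. variable_difference * D = p \<otimes> 1 - 1 \<otimes> p"
  proof (induction p)
    case (pCons c a)
    then obtain D where "variable_difference * D = a \<otimes> 1 - 1 \<otimes> a" by blast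
    then have "(tvar \<otimes> 1) * (variable_difference * D) = (tvar \<otimes> 1) * (a \<otimes> 1 - 1 \<otimes> a)"
      by simp
    then have "variable_difference * ((tvar \<otimes> 1) * D + 1 \<otimes> a) = pCons c a \<otimes> 1 - 1 \<otimes> pCons c a"
      unfolding tensor2_pCons by (simp add: algebra_simps)
    then show ?case by blast
  qed (auto simp: tensor2_zero intro: exI[of _ 0])
  then show ?thesis
    unfolding divided_difference_def using variable_difference_cancel by (metis (mono_tags, lifting) theI)
qed

lemma divided_difference_eqI:
  "variable_difference * D = p \<otimes> 1 - 1 \<otimes> p \<Longrightarrow> divided_difference p = D"
  using variable_difference_mult_divided_difference variable_difference_cancel by metis

lemma divided_difference_tvar: "divided_difference tvar = 1"
  by (rule divided_difference_eqI) simp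

lemma divided_difference_zero: "divided_difference 0 = 0"
  by (rule divided_difference_eqI) (simp add: tensor2_zero)

lemma divided_difference_add:
  "divided_difference (p + q) = divided_difference p + divided_difference q"
  by (rule divided_difference_eqI)
     (simp add: distrib_left variable_difference_mult_divided_difference tensor2_linear)

lemma divided_difference_smult:
  "divided_difference (smult c p) = tscale c (divided_difference p)"
  by (rule divided_difference_eqI)
     (simp add: tscale_mult_right variable_difference_mult_divided_difference tensor2_linear
       tscale.scale_right_diff_distrib)

lemma divided_difference_mult:
  "divided_difference (p * q) = (p \<otimes> 1) * divided_difference q + divided_difference p * (1 \<otimes> q)"
proof (rule divided_difference_eqI)
  have "variable_difference * ((p \<otimes> 1) * divided_difference q + divided_difference p * (1 \<otimes> q))
      = (p \<otimes> 1) * (variable_difference * divided_difference q)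
        + (variable_difference * divided_difference p) * (1 \<otimes> q)"
    by (simp only: distrib_left mult_ac)
  also have "\<dots> = (p * q) \<otimes> 1 - 1 \<otimes> (p * q)"
    unfolding variable_difference_mult_divided_difference by (simp add: ring_distribs tensor2_mult)
  finally show "variable_difference * ((p \<otimes> 1) * divided_difference q + divided_difference p * (1 \<otimes> q))
      = (p * q) \<otimes> 1 - 1 \<otimes> (p * q)" .
qed

lemma divided_difference_pCons:
  "divided_difference (pCons c p) = (tvar \<otimes> 1) * divided_difference p + 1 \<otimes> p"
proof -
  have "(tvar \<otimes> 1) * (variable_difference * divided_difference p)
     = (tvar \<otimes> 1) * (p \<otimes> 1 - 1 \<otimes> p)"
    by (simp only: variable_difference_mult_divided_difference)
  then show ?thesis
    by (intro divided_difference_eqI) (simp add: tensor2_pCons algebra_simps)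
qed

section \<open>Exchanging the two factors\<close>

abbreviation exchange :: "('a::comm_ring_1, 2) poly_tensor \<Rightarrow> ('a, 2) poly_tensor" where
  "exchange \<equiv> tperm (transpose 1 2)"

lemma tperm_hom: "bij \<sigma> \<Longrightarrow> module_hom tscale tscale (tperm \<sigma>)"
  unfolding tperm_def by (rule tscale.tlift_module_hom[OF tperm_multilinear])

lemma tperm_mult: "bij \<sigma> \<Longrightarrow> tperm \<sigma> (X * Y) = tperm \<sigma> X * tperm \<sigma> Y"
  by (rule tensor_hom_mult[OF tperm_hom])
     (simp_all add: tscale_mult_left tperm_ptensor ptensor_times)

lemmas tperm_add = module_hom.add[OF tperm_hom]
  and tperm_diff = module_hom.diff[OF tperm_hom]
  and tperm_scale = module_hom.scale[OF tperm_hom]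

lemmas exchange_mult = tperm_mult[OF bij_transpose]
  and exchange_add = tperm_add[OF bij_transpose]
  and exchange_diff = tperm_diff[OF bij_transpose]

lemma exchange_tensor2: "exchange (a \<otimes> b) = b \<otimes> a"
  by (simp add: tensor2_def tperm_ptensor) (simp add: ptensor_eq_tensor2)

lemma exchange_divided_difference: "exchange (divided_difference p) = divided_difference p"
proof -
  have "exchange (variable_difference * divided_difference p) = 1 \<otimes> p - p \<otimes> 1"
    by (simp add: variable_difference_mult_divided_difference exchange_diff exchange_tensor2)
  then show ?thesis
    by (intro divided_difference_eqI[symmetric])
       (simp add: exchange_mult exchange_diff exchange_tensor2 algebra_simps)
qed

section \<open>Double brackets\<close>

definition bracket_map ::
    "('a::comm_ring_1, 2) poly_tensor \<Rightarrow> ('a, 2) poly_tensor \<Rightarrow> ('a, 2) poly_tensor" where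
  "bracket_map e = tlift tscale (\<lambda>f. e * divided_difference (f 1) * divided_difference (f 2))"

lemma bracket_map_multilinear:
  "multilinear_map tscale (\<lambda>f. e * divided_difference (f 1) * divided_difference (f (2::2)))"
  by (rule multilinear_map_2I[where B = "\<lambda>a b. e * divided_difference a * divided_difference b"])
     (simp_all add: divided_difference_add divided_difference_smult ring_distribs
        tscale_mult_left tscale_mult_right)

lemma bracket_map_hom: "module_hom tscale tscale (bracket_map e)"
  unfolding bracket_map_def by (rule tscale.tlift_module_hom[OF bracket_map_multilinear])

lemma bracket_map_tensor2:
  "bracket_map e (a \<otimes> b) = e * divided_difference a * divided_difference b"
  by (simp add: bracket_map_def tensor2_def tscale.tlift_ptensor[OF bracket_map_multilinear])

lemma bracket_map_tvar: "bracket_map e (tvar \<otimes> tvar) = e"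
  by (simp only: bracket_map_tensor2 divided_difference_tvar mult_1_right)

lemma tscale_hom: "module_hom tscale tscale F \<Longrightarrow> module_hom tscale tscale (\<lambda>X. tscale c (F X))"
  by (auto simp: module_hom_def module_hom_axioms_def tscale.scale_right_distrib mult.commute)

lemma tscale_bracket_map: "(\<lambda>X. tscale c (bracket_map e X)) = bracket_map (tscale c e)"
  by (rule ext, rule tensor2_hom_eqI[OF tscale_hom[OF bracket_map_hom] bracket_map_hom])
     (simp add: bracket_map_tensor2 tscale_mult_left)

text \<open>
  The derivation property is the Leibniz rule for divided differences, and the antisymmetry is that
  of \<open>e\<close>, since divided differences are symmetric.
\<close>

lemma bracket_map_double_bracket:
  assumes "exchange e = - e"
  shows "double_bracket (bracket_map e)"
  unfolding double_bracket_def Let_def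
proof (intro conjI allI)
  show "derivation_last (bracket_map e)"
    unfolding derivation_last_def
    by (simp add: bracket_map_tensor2 divided_difference_mult algebra_simps)
  have hom: "module_hom tscale tscale (exchange \<circ> bracket_map e \<circ> exchange)"
    by (intro module_hom_compose[where ?s2.0 = tscale] tperm_hom bracket_map_hom bij_transpose)
  have "module_hom tscale tscale (\<lambda>X. - bracket_map e X)"
    using tscale_hom[OF bracket_map_hom, of "- 1" e] by simp
  from tensor2_hom_eqI[OF hom this]
  show "(exchange \<circ> bracket_map e \<circ> exchange) X = - bracket_map e X" for X
    by (simp add: exchange_tensor2 bracket_map_tensor2 exchange_mult exchange_divided_difference
       assms mult_ac)
qed (rule bracket_map_hom)

text \<open>
  The derivation property in the last argument gives \<open>\<phi>(c \<otimes> p) = \<phi>(c \<otimes> t) \<Delta>p\<close>; exchanging the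
  arguments gives \<open>\<phi>(p \<otimes> t) = \<phi>(t \<otimes> t) \<Delta>p\<close>.
\<close>

lemma double_bracket_value:
  assumes "double_bracket \<phi>"
  shows "exchange (\<phi> (tvar \<otimes> tvar)) = - \<phi> (tvar \<otimes> tvar)"
    and "\<phi> = bracket_map (\<phi> (tvar \<otimes> tvar))"
proof -
  interpret \<phi>: module_hom tscale tscale \<phi>
    using assms by (simp add: double_bracket_def)
  have der: "\<phi> (c \<otimes> (a * b)) = (a \<otimes> 1) * \<phi> (c \<otimes> b) + \<phi> (c \<otimes> a) * (1 \<otimes> b)" for a b c
    using assms by (simp add: double_bracket_def derivation_last_def)
  have anti: "exchange (\<phi> (exchange X)) = - \<phi> X" for X
    using assms by (simp add: double_bracket_def Let_def)
  from anti[of "tvar \<otimes> tvar"] show "exchange (\<phi> (tvar \<otimes> tvar)) = - \<phi> (tvar \<otimes> tvar)"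
    by (simp add: exchange_tensor2)
  \<comment> \<open>A derivation vanishes at \<open>1 = 1 * 1\<close>.\<close>
  have one: "\<phi> (c \<otimes> 1) = 0" for c
    using der[of c 1 1] by (simp add: tensor2_one)
  have right: "\<phi> (c \<otimes> p) = \<phi> (c \<otimes> tvar) * divided_difference p" for c p
  proof (induction p)
    case 0
    show ?case by (simp add: tensor2_zero \<phi>.zero divided_difference_zero)
  next
    case (pCons a p)
    have "pCons a p = smult a 1 + tvar * p" by (simp add: monom_altdef)
    then have "\<phi> (c \<otimes> pCons a p) = \<phi> (c \<otimes> (tvar * p))"
      by (simp only: tensor2_linear \<phi>.add \<phi>.scale one) simp
    also have "\<dots> = (tvar \<otimes> 1) * (\<phi> (c \<otimes> tvar) * divided_difference p)
        + \<phi> (c \<otimes> tvar) * (1 \<otimes> p)"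
      by (simp only: der pCons)
    also have "\<dots> = \<phi> (c \<otimes> tvar) * divided_difference (pCons a p)"
      by (simp only: divided_difference_pCons distrib_left mult_ac)
    finally show ?case .
  qed
  have left: "\<phi> (p \<otimes> tvar) = \<phi> (tvar \<otimes> tvar) * divided_difference p" for p
  proof -
    have "- \<phi> (p \<otimes> tvar) = exchange (\<phi> (tvar \<otimes> p))"
      using anti[of "p \<otimes> tvar"] by (simp add: exchange_tensor2)
    also have "\<dots> = exchange (\<phi> (tvar \<otimes> tvar)) * divided_difference p"
      by (subst right) (simp add: exchange_mult exchange_divided_difference)
    also have "exchange (\<phi> (tvar \<otimes> tvar)) = - \<phi> (tvar \<otimes> tvar)" by fact
    finally show ?thesis by simp
  qed
  show "\<phi> = bracket_map (\<phi> (tvar \<otimes> tvar))"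
    by (rule ext, rule tensor2_hom_eqI[OF \<phi>.module_hom_axioms bracket_map_hom])
       (subst right, subst left, rule bracket_map_tensor2[symmetric])
qed

lemma ex1_double_bracket:
  assumes "exchange e = - e"
  shows "\<exists>!\<phi>. double_bracket \<phi> \<and> \<phi> (tvar \<otimes> tvar) = e"
proof (intro ex1I conjI)
  show "double_bracket (bracket_map e)" by (rule bracket_map_double_bracket[OF assms])
  show "bracket_map e (tvar \<otimes> tvar) = e" by (rule bracket_map_tvar)
  show "\<phi> = bracket_map e" if "double_bracket \<phi> \<and> \<phi> (tvar \<otimes> tvar) = e" for \<phi>
    using that double_bracket_value(2) by metis
qed

lemma bracket_of_eq_bracket_map:
  assumes "exchange e = - e"
  shows "bracket_of e = bracket_map e"
  unfolding bracket_of_def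
  using bracket_map_double_bracket[OF assms] bracket_map_tvar ex1_double_bracket[OF assms]
  by (intro the1_equality) auto

section \<open>Antisymmetric elements\<close>

lemma expand2_one_tensor: "expand2 (1 \<otimes> p) = [:p:]"
  by (simp add: expand2_tensor2)

text \<open>
  Modulo \<open>x - y\<close> an antisymmetric element equals its negative, so without 2-torsion it is divisible
  by \<open>x - y\<close>.  The quotient is symmetric because \<open>x - y\<close> is antisymmetric and not a zero divisor.
\<close>

lemma antisymmetric_factorization:
  assumes torsion_free: "\<And>x::'a::comm_ring_1. 2 * x = 0 \<Longrightarrow> x = 0"
    and anti: "exchange e = - (e :: ('a, 2) poly_tensor)"
  obtains s where "e = variable_difference * s" "exchange s = s"
proof -
  have "\<exists>p Q. X = 1 \<otimes> p + variable_difference * Q" for X :: "('a, 2) poly_tensor"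
  proof (induction X rule: poly_tensor_induct)
    case zero
    have "0 = 1 \<otimes> 0 + variable_difference * 0" by (simp add: tensor2_zero)
    then show ?case by blast
  next
    case (add c f X)
    obtain p Q where X: "X = 1 \<otimes> p + variable_difference * Q" using add by blast
    define a b where "a = f 1" "b = f 2"
    have "tscale c (ptensor f) = tscale c ((1 \<otimes> b) * (a \<otimes> 1))"
      by (simp add: ptensor_eq_tensor2 tensor2_mult a_b_def)
    also have "a \<otimes> 1 = 1 \<otimes> a + variable_difference * divided_difference a"
      by (simp add: variable_difference_mult_divided_difference)
    also have "tscale c ((1 \<otimes> b) * (1 \<otimes> a + variable_difference * divided_difference a))
       = 1 \<otimes> smult c (b * a) + variable_difference * (tscale c (1 \<otimes> b) * divided_difference a)"
      by (simp add: distrib_left tensor2_mult tensor2_linear(4) tscale.scale_right_distrib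
          tscale_mult_left tscale_mult_right mult.left_commute)
    finally have "tscale c (ptensor f) + X = 1 \<otimes> (smult c (b * a) + p)
        + variable_difference * (tscale c (1 \<otimes> b) * divided_difference a + Q)"
      by (simp only: X tensor2_linear(3) distrib_left distrib_right ac_simps)
    then show ?case by blast
  qed
  then obtain p Q where e: "e = 1 \<otimes> p + variable_difference * Q" by blast
  have "e + exchange e = 1 \<otimes> p + p \<otimes> 1 + variable_difference * (Q - exchange Q)"
    by (simp add: e exchange_add exchange_mult exchange_diff exchange_tensor2 algebra_simps)
  also have "p \<otimes> 1 = 1 \<otimes> p + variable_difference * divided_difference p"
    by (simp add: variable_difference_mult_divided_difference)
  finally have "e + exchange e = 1 \<otimes> p + (1 \<otimes> p + variable_difference * divided_difference p)
      + variable_difference * (Q - exchange Q)" .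
  then have sum: "1 \<otimes> p + 1 \<otimes> p
      + variable_difference * (divided_difference p + (Q - exchange Q)) = 0"
    by (simp only: anti add.right_inverse distrib_left add.assoc)
  \<comment> \<open>Setting both variables equal.\<close>
  have "p + p = poly (expand2 (1 \<otimes> p + 1 \<otimes> p
      + variable_difference * (divided_difference p + (Q - exchange Q)))) tvar"
    by (simp only: expand2_add expand2_mult expand2_diff expand2_vars expand2_one_tensor) simp
  also have "\<dots> = 0"
    by (simp only: sum expand2_zero poly_0)
  finally have "p + p = 0" .
  have "2 * coeff p i = 0" for i
    using arg_cong[OF \<open>p + p = 0\<close>, of "\<lambda>q. coeff q i"] by (simp only: coeff_add coeff_0 mult_2)
  then have "p = 0" using torsion_free by (simp add: poly_eq_iff)
  then have eQ: "e = variable_difference * Q" by (simp add: e tensor2_zero)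
  moreover have "variable_difference * exchange Q = - exchange e"
    by (simp add: eQ exchange_mult exchange_diff exchange_tensor2 algebra_simps)
  then have "exchange Q = Q" using anti eQ by (simp add: variable_difference_cancel)
  ultimately show thesis by (rule that)
qed

section \<open>Placing a tensor square inside the tensor cube\<close>

text \<open>
  The substitutions of the variables \<open>(x,y)\<close>, \<open>(y,z)\<close> and \<open>(x,z)\<close> into an element of \<open>R[x,y]\<close>.
\<close>

definition place12 :: "('a::comm_ring_1, 2) poly_tensor \<Rightarrow> ('a, 3) poly_tensor" where
  "place12 X = append_factor X 1"

definition place23 :: "('a::comm_ring_1, 2) poly_tensor \<Rightarrow> ('a, 3) poly_tensor" where
  "place23 X = prepend_factor 1 X"

definition place13 :: "('a::comm_ring_1, 2) poly_tensor \<Rightarrow> ('a, 3) poly_tensor" where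
  "place13 = tlift tscale (\<lambda>f. tensor3 (f 1) 1 (f 2))"

lemma place13_multilinear: "multilinear_map tscale (\<lambda>f. tensor3 (f (1::2)) 1 (f 2))"
  by (rule multilinear_map_2I[where B = "\<lambda>a b. tensor3 a 1 b"]) (simp_all add: tensor3_linear)

lemma place_hom:
  "module_hom tscale tscale place12" "module_hom tscale tscale place23"
  "module_hom tscale tscale place13"
  unfolding place12_def place23_def place13_def append_factor_def prepend_factor_def
  by (intro tscale.tlift_module_hom append_factor_multilinear prepend_factor_multilinear
      place13_multilinear)+

lemma place_tensor2:
  "place12 (a \<otimes> b) = tensor3 a b 1" "place23 (a \<otimes> b) = tensor3 1 a b"
  "place13 (a \<otimes> b) = tensor3 a 1 b"
  by (simp_all add: place12_def place23_def append_factor_tensor2 prepend_factor_tensor2)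
     (simp add: place13_def tensor2_def tscale.tlift_ptensor[OF place13_multilinear])

lemma place_mult:
  "place12 (X * Y) = place12 X * place12 Y" "place23 (X * Y) = place23 X * place23 Y"
  "place13 (X * Y) = place13 X * place13 Y"
  by (rule tensor_hom_mult[OF place_hom(1)] tensor_hom_mult[OF place_hom(2)]
        tensor_hom_mult[OF place_hom(3)];
      simp add: tscale_mult_left ptensor_eq_tensor2 tensor2_mult place_tensor2 tensor3_mult)+

lemma place_one: "place12 1 = 1" "place23 1 = 1" "place13 1 = 1"
  by (simp_all add: place_tensor2 tensor3_one flip: tensor2_one)

lemmas place_diff = place_hom[THEN module_hom.diff]
  and place_add = place_hom[THEN module_hom.add]
  and place_scale = place_hom[THEN module_hom.scale]

lemma append_factor_conv_place: "append_factor X c = place12 X * tensor3 1 1 c"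
proof (rule tensor2_hom_eqI[where F = "\<lambda>X. append_factor X c" and G = "\<lambda>X. place12 X * tensor3 1 1 c"])
  show "module_hom tscale tscale (\<lambda>X. append_factor X c)"
    by unfold_locales (simp_all add: append_factor_linear)
  show "module_hom tscale tscale (\<lambda>X. place12 X * tensor3 1 1 c)"
    by unfold_locales (simp_all add: place_add place_scale distrib_right tscale_mult_left)
qed (simp add: append_factor_tensor2 place_tensor2 tensor3_mult)

section \<open>The cyclic action\<close>

abbreviation cycle3 :: "3 \<Rightarrow> 3" where "cycle3 \<equiv> (\<lambda>i. i + 1)"

lemma cycle3_cube: "cycle3 (cycle3 (cycle3 i)) = i"
proof -
  have "(1::3) + 1 + 1 = 0" by simp
  then show ?thesis by (simp add: add.assoc)
qed

lemma bij_cycle3: "bij cycle3" "bij (cycle3 \<circ> cycle3)"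
proof -
  show "bij cycle3" by (rule bij_plus_right)
  then show "bij (cycle3 \<circ> cycle3)" by (intro bij_comp)
qed

lemma inv_cycle3: "inv cycle3 = cycle3 \<circ> cycle3" "inv (cycle3 \<circ> cycle3) = cycle3"
  by (rule inv_equality; simp only: o_apply cycle3_cube)+

lemma cyclic_perms_3: "cyclic_perms = {id, cycle3, cycle3 \<circ> cycle3}"
proof -
  have cube: "cycle3 ^^ 3 = id"
    by (simp only: numeral_3_eq_3 funpow.simps o_id) (simp only: fun_eq_iff o_apply id_apply cycle3_cube, simp)
  have "cycle3 ^^ k = cycle3 ^^ (k mod 3)" for k
  proof -
    have "cycle3 ^^ k = (cycle3 ^^ 3) ^^ (k div 3) \<circ> cycle3 ^^ (k mod 3)"
      by (simp only: funpow_mult flip: funpow_add) simp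
    then show ?thesis by (simp only: cube id_funpow id_o)
  qed
  moreover have "k mod 3 \<in> {0, 1, 2}" for k :: nat by auto
  ultimately have "cyclic_perms = (\<lambda>k. cycle3 ^^ k) ` {0, 1, 2}"
    unfolding cyclic_perms_def by (safe; metis (no_types, lifting) image_iff rangeI)
  also have "\<dots> = {id, cycle3, cycle3 \<circ> cycle3}"
    by (simp only: image_insert image_empty numeral_2_eq_2 One_nat_def funpow.simps o_id)
  finally show ?thesis .
qed

lemma sum_cyclic_perms_3:
  "(\<Sum>\<sigma>\<in>cyclic_perms. F \<sigma>) = F id + F cycle3 + F (cycle3 \<circ> cycle3)"
proof -
  have "id 0 \<noteq> cycle3 0" "id 0 \<noteq> (cycle3 \<circ> cycle3) 0" "cycle3 0 \<noteq> (cycle3 \<circ> cycle3) 0" by simp_all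
  then have "id \<noteq> cycle3" "id \<noteq> cycle3 \<circ> cycle3" "cycle3 \<noteq> cycle3 \<circ> cycle3" by metis+
  then show ?thesis by (simp only: cyclic_perms_3) (simp add: add.assoc)
qed

lemma tperm_cycle3_tensor3:
  "tperm cycle3 (tensor3 a b c) = tensor3 c a b"
  "tperm (cycle3 \<circ> cycle3) (tensor3 a b c) = tensor3 b c a"
  unfolding tensor3_def
  by (simp_all only: tperm_ptensor bij_cycle3 inv_cycle3) (simp_all add: ptensor_eq_tensor3)

lemma tperm_id: "tperm id X = X" for X :: "('a::comm_ring_1, 3) poly_tensor"
  by (rule tensor3_hom_eqI[where s = tscale and F = "tperm id" and G = "\<lambda>X. X"])
     (simp_all only: tperm_hom tscale.module_hom_ident tperm_ptensor tensor3_def bij_id inv_id id_apply)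

text \<open>
  The cycle substitutes \<open>x \<mapsto> y \<mapsto> z \<mapsto> x\<close>; a pair of variables that wraps around comes
  back in reversed order, which explains the occurrences of \<open>exchange\<close>.
\<close>

lemma tperm_cycle3_place:
  "tperm cycle3 (place12 X) = place23 X"
  "tperm cycle3 (place23 X) = place13 (exchange X)"
  "tperm cycle3 (place13 X) = place12 (exchange X)"
  "tperm (cycle3 \<circ> cycle3) (place12 X) = place13 (exchange X)"
  "tperm (cycle3 \<circ> cycle3) (place23 X) = place12 X"
  "tperm (cycle3 \<circ> cycle3) (place13 X) = place23 (exchange X)"
proof -
  note homs = module_hom_compose[where ?s2.0 = tscale, OF place_hom(1) tperm_hom, unfolded o_def]
    module_hom_compose[where ?s2.0 = tscale, OF place_hom(2) tperm_hom, unfolded o_def]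
    module_hom_compose[where ?s2.0 = tscale, OF place_hom(3) tperm_hom, unfolded o_def]
    module_hom_compose[where ?s2.0 = tscale, OF tperm_hom[OF bij_transpose] place_hom(1), unfolded o_def]
    module_hom_compose[where ?s2.0 = tscale, OF tperm_hom[OF bij_transpose] place_hom(2), unfolded o_def]
    module_hom_compose[where ?s2.0 = tscale, OF tperm_hom[OF bij_transpose] place_hom(3), unfolded o_def]
    place_hom
  show  "tperm cycle3 (place12 X) = place23 X"
  "tperm cycle3 (place23 X) = place13 (exchange X)"
  "tperm cycle3 (place13 X) = place12 (exchange X)"
  "tperm (cycle3 \<circ> cycle3) (place12 X) = place13 (exchange X)"
  "tperm (cycle3 \<circ> cycle3) (place23 X) = place12 X"
  "tperm (cycle3 \<circ> cycle3) (place13 X) = place23 (exchange X)"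
    by (rule tensor2_hom_eqI[where s = tscale]; (intro homs bij_cycle3[unfolded o_def] bij_cycle3)?;
       simp only: place_tensor2 tperm_cycle3_tensor3 exchange_tensor2)+
qed

section \<open>The double Jacobiator\<close>

text \<open>
  The value of the Jacobiator at \<open>t \<otimes> t \<otimes> t\<close> for the bracket with value \<open>(x - y) s\<close>, where \<open>s\<close>
  is symmetric.  When \<open>s\<close> is invertible, its vanishing says that \<open>(x - y) / s(x,y)\<close> is an additive
  cocycle.
\<close>

definition jacobi_element :: "('a::comm_ring_1, 2) poly_tensor \<Rightarrow> ('a, 3) poly_tensor" where
  "jacobi_element s =
     place23 variable_difference * place12 s * place13 s
     - place13 variable_difference * place12 s * place23 s
     + place12 variable_difference * place23 s * place13 s"

text \<open>
  This is \<open>p(x) - p(z) = (p(x) - p(y)) + (p(y) - p(z))\<close>.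
\<close>

lemma place_divided_difference_cocycle:
  "place13 variable_difference * place13 (divided_difference p)
     = place12 variable_difference * place12 (divided_difference p)
       + place23 variable_difference * place23 (divided_difference p)"
  unfolding place_mult[symmetric] variable_difference_mult_divided_difference
  by (simp add: place_diff place_tensor2)

text \<open>
  The three summands on the left are the rotated terms of the Jacobiator.  Each product of two of
  the \<open>s\<close> occurs in two of them, and the cocycle relation for \<open>b\<close>, \<open>c\<close> and \<open>a\<close>, respectively,
  combines the two into one term.
\<close>

lemma cyclic_sum_identity:
  fixes x12 :: "'b::comm_ring_1"
  assumes "x13 * a13 = x12 * a12 + x23 * a23" "x13 * b13 = x12 * b12 + x23 * b23"
    "x13 * c13 = x12 * c12 + x23 * c23"
  shows "s12 * a12 * (s13 * (x13 * b13) * c13 - s23 * x23 * b23 * c23)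
     + s23 * b23 * (s13 * (x13 * a13) * c13 - s12 * x12 * a12 * c12)
     - s13 * c13 * (s23 * x23 * a23 * b23 + s12 * x12 * a12 * b12)
     = (x23 * s12 * s13 - x13 * s12 * s23 + x12 * s23 * s13) * (a12 * b23 * c13)"
proof -
  have "x13 * s12 * s23 * (a12 * b23 * c13) = s12 * s23 * (a12 * b23) * (x13 * c13)"
    by (simp only: mult_ac)
  then show ?thesis unfolding left_diff_distrib distrib_right unfolding assms by (simp add: algebra_simps)
qed

lemma hom_tensor_id_hom:
  assumes "module_hom tscale tscale \<phi>"
  shows "module_hom tscale tscale (hom_tensor_id \<phi>)"
proof -
  interpret \<phi>: module_hom tscale tscale \<phi> by fact
  show ?thesis
    unfolding hom_tensor_id_def
    by (rule tscale.tlift_module_hom,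
        rule multilinear_map_3I[where B = "\<lambda>a b c. append_factor (\<phi> (a \<otimes> b)) c"])
       (simp_all add: tensor2_linear \<phi>.add \<phi>.scale append_factor_linear)
qed

lemma id_tensor_hom_hom:
  assumes "module_hom tscale tscale \<phi>"
  shows "module_hom tscale tscale (id_tensor_hom \<phi>)"
proof -
  interpret \<phi>: module_hom tscale tscale \<phi> by fact
  show ?thesis
    unfolding id_tensor_hom_def
    by (rule tscale.tlift_module_hom,
        rule multilinear_map_3I[where B = "\<lambda>a b c. prepend_factor a (\<phi> (b \<otimes> c))"])
       (simp_all add: tensor2_linear \<phi>.add \<phi>.scale prepend_factor_linear)
qed

text \<open>
  The bracket sends \<open>a \<otimes> p\<close> to \<open>s \<Delta>a (p(x) - p(y))\<close>, because the factor \<open>x - y\<close> of its value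
  cancels the denominator of \<open>\<Delta>p\<close>.
\<close>

lemma hom_tensor_id_bracket_map:
  assumes "\<phi> = bracket_map (variable_difference * s)"
  shows "hom_tensor_id \<phi> (prepend_factor a X)
     = place12 (s * divided_difference a) * (place13 X - place23 X)"
proof (rule tensor2_hom_eqI[where s = tscale
      and G = "\<lambda>X. place12 (s * divided_difference a) * (place13 X - place23 X)"
      and F = "\<lambda>X. hom_tensor_id \<phi> (prepend_factor a X)"])
  have hom: "module_hom tscale tscale \<phi>" by (simp add: assms bracket_map_hom)
  interpret H: module_hom tscale tscale "hom_tensor_id \<phi>" by (rule hom_tensor_id_hom[OF hom])
  show "module_hom tscale tscale (\<lambda>X. hom_tensor_id \<phi> (prepend_factor a X))"
    by unfold_locales (simp_all add: prepend_factor_linear H.add H.scale)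
  show "module_hom tscale tscale (\<lambda>X. place12 (s * divided_difference a) * (place13 X - place23 X))"
    by unfold_locales (simp_all add: place_add place_scale tscale_mult_left tscale_mult_right algebra_simps
       tscale.scale_right_diff_distrib)
  fix p q
  have "hom_tensor_id \<phi> (prepend_factor a (p \<otimes> q))
      = place12 (s * divided_difference a * (variable_difference * divided_difference p)) * tensor3 1 1 q"
    by (simp only: prepend_factor_tensor2 hom_tensor_id_tensor3[OF hom] append_factor_conv_place
        bracket_map_tensor2[of "variable_difference * s", folded assms] mult_ac)
  also have "\<dots> = place12 (s * divided_difference a) * ((place12 (p \<otimes> 1) - place12 (1 \<otimes> p)) * tensor3 1 1 q)"
    by (simp only: variable_difference_mult_divided_difference place_mult place_diff mult.assoc)
  also have "(place12 (p \<otimes> 1) - place12 (1 \<otimes> p)) * tensor3 1 1 q = place13 (p \<otimes> q) - place23 (p \<otimes> q)"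
    by (simp only: left_diff_distrib place_tensor2 tensor3_mult mult_1 mult_1_right)
  finally show "hom_tensor_id \<phi> (prepend_factor a (p \<otimes> q))
     = place12 (s * divided_difference a) * (place13 (p \<otimes> q) - place23 (p \<otimes> q))" .
qed

lemma double_jacobiator_tensor3:
  assumes s: "exchange s = s" and \<phi>: "\<phi> = bracket_map (variable_difference * s)"
  shows "double_jacobiator \<phi> (tensor3 a b c) = jacobi_element s *
    (place12 (divided_difference a) * place23 (divided_difference b) * place13 (divided_difference c))"
proof -
  have hom: "module_hom tscale tscale \<phi>" by (simp add: \<phi> bracket_map_hom)
  have T: "(hom_tensor_id \<phi> \<circ> id_tensor_hom \<phi>) (tensor3 a b c)
     = place12 s * place12 (divided_difference a) *
       (place13 s * (place13 variable_difference * place13 (divided_difference b)) * place13 (divided_difference c)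
      - place23 s * place23 variable_difference * place23 (divided_difference b) * place23 (divided_difference c))"
    for a b c
    unfolding o_apply id_tensor_hom_tensor3[OF hom] hom_tensor_id_bracket_map[OF \<phi>]
    by (simp only: \<phi> bracket_map_tensor2 place_mult mult_ac)
  have exd: "exchange variable_difference = - variable_difference"
    by (simp add: exchange_diff exchange_tensor2)
  have neg: "place12 (- X) = - place12 X" "place13 (- X) = - place13 X" "place23 (- X) = - place23 X" for X
    using place_hom by (metis module_hom.neg)+
  note cyc = tperm_mult[OF bij_cycle3(1)] tperm_mult[OF bij_cycle3(2)] tperm_diff[OF bij_cycle3(1)]
    tperm_diff[OF bij_cycle3(2)] tperm_cycle3_place s exd exchange_divided_difference neg
  have "double_jacobiator \<phi> (tensor3 a b c)
    = (hom_tensor_id \<phi> \<circ> id_tensor_hom \<phi>) (tensor3 a b c)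
     + tperm cycle3 ((hom_tensor_id \<phi> \<circ> id_tensor_hom \<phi>) (tensor3 b c a))
     + tperm (cycle3 \<circ> cycle3) ((hom_tensor_id \<phi> \<circ> id_tensor_hom \<phi>) (tensor3 c a b))"
    by (simp add: double_jacobiator_def sum_cyclic_perms_3 hom_action_def inv_cycle3 tperm_id
        tperm_cycle3_tensor3)
  also have "\<dots> = jacobi_element s *
    (place12 (divided_difference a) * place23 (divided_difference b) * place13 (divided_difference c))"
    unfolding T cyc jacobi_element_def
      cyclic_sum_identity[OF place_divided_difference_cocycle[of a] place_divided_difference_cocycle[of b]
        place_divided_difference_cocycle[of c], symmetric]
    by (simp add: algebra_simps)
  finally show ?thesis .
qed

lemma double_jacobiator_hom:
  assumes "module_hom tscale tscale \<phi>"
  shows "module_hom tscale tscale (double_jacobiator \<phi>)"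
proof -
  have "module_hom tscale tscale (hom_action \<sigma> (hom_tensor_id \<phi> \<circ> id_tensor_hom \<phi>))" if "bij \<sigma>" for \<sigma> :: "3 \<Rightarrow> 3"
    unfolding hom_action_def
    by (intro module_hom_compose[where ?s2.0 = tscale] tperm_hom hom_tensor_id_hom id_tensor_hom_hom
        assms that bij_imp_bij_inv)
  from this[OF bij_id] this[OF bij_cycle3(1)] this[OF bij_cycle3(2)]
  show ?thesis
    unfolding double_jacobiator_def sum_cyclic_perms_3
    by (auto simp: module_hom_def module_hom_axioms_def tscale.scale_right_distrib)
qed

lemma double_poisson_bracket_map_iff:
  assumes "exchange s = s"
  shows "double_poisson (bracket_map (variable_difference * s)) \<longleftrightarrow> jacobi_element s = 0"
proof -
  let ?\<phi> = "bracket_map (variable_difference * s)"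
  have "exchange (variable_difference * s) = - (variable_difference * s)"
    by (simp add: exchange_mult exchange_diff exchange_tensor2 assms algebra_simps)
  then have "double_bracket ?\<phi>" by (rule bracket_map_double_bracket)
  moreover have "(\<forall>X. double_jacobiator ?\<phi> X = 0) \<longleftrightarrow> jacobi_element s = 0"
  proof
    assume "\<forall>X. double_jacobiator ?\<phi> X = 0"
    then have "double_jacobiator ?\<phi> (tensor3 tvar tvar tvar) = 0" by blast
    then show "jacobi_element s = 0"
      by (simp add: double_jacobiator_tensor3[OF assms refl] divided_difference_tvar place_one)
  next
    assume J: "jacobi_element s = 0"
    interpret J: module_hom tscale tscale "double_jacobiator ?\<phi>"
      by (rule double_jacobiator_hom[OF bracket_map_hom])
    have "double_jacobiator ?\<phi> X = 0" for X
      by (induction X rule: poly_tensor_induct)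
         (simp_all add: J.zero J.add J.scale ptensor_eq_tensor3 double_jacobiator_tensor3[OF assms refl] J
           del: mult_eq_0_iff)
    then show "\<forall>X. double_jacobiator ?\<phi> X = 0" by blast
  qed
  ultimately show ?thesis by (simp add: double_poisson_def)
qed

section \<open>Brackets of degree at most one in each variable\<close>

text \<open>
  The general symmetric polynomial of degree at most 1 in each of \<open>x\<close> and \<open>y\<close>.
\<close>

definition bilinear_symbol :: "'a::comm_ring_1 \<Rightarrow> 'a \<Rightarrow> 'a \<Rightarrow> ('a, 2) poly_tensor" where
  "bilinear_symbol l m n = tscale l 1 + tscale m (tvar \<otimes> 1 + 1 \<otimes> tvar) + tscale n (tvar \<otimes> tvar)"

lemma exchange_bilinear_symbol: "exchange (bilinear_symbol l m n) = bilinear_symbol l m n"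
  by (simp add: bilinear_symbol_def exchange_add exchange_tensor2 tperm_scale add.commute
      flip: tensor2_one)

lemma bracket_value_factorization:
  "bracket_value l m n = variable_difference * bilinear_symbol l m n"
  by (simp add: bracket_value_def bilinear_symbol_def distrib_left tscale_mult_right)
     (simp add: algebra_simps tensor2_mult power2_eq_square)

lemma exchange_bracket_value: "exchange (bracket_value l m n) = - bracket_value l m n"
  by (simp add: bracket_value_factorization exchange_mult exchange_bilinear_symbol exchange_diff
      exchange_tensor2 algebra_simps)

lemma jacobi_element_bilinear_symbol:
  "jacobi_element (bilinear_symbol l m n) = tscale (m\<^sup>2 - l * n)
     (place12 variable_difference * place23 variable_difference * place13 variable_difference)"
proof -
  define L M N where "L = tscale l (1 :: ('a, 3) poly_tensor)" "M = tscale m (1 :: ('a, 3) poly_tensor)"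
    "N = tscale n (1 :: ('a, 3) poly_tensor)"
  define x y z :: "('a, 3) poly_tensor"
    where "x = tensor3 tvar 1 1" "y = tensor3 1 tvar 1" "z = tensor3 1 1 tvar"
  have symbol: "place12 (bilinear_symbol l m n) = L + M * (x + y) + N * (x * y)"
    "place23 (bilinear_symbol l m n) = L + M * (y + z) + N * (y * z)"
    "place13 (bilinear_symbol l m n) = L + M * (x + z) + N * (x * z)"
    unfolding bilinear_symbol_def L_M_N_def x_y_z_def
    by (simp_all add: place_add place_scale place_one place_tensor2 tensor3_mult tscale_mult_left)
  have diff: "place12 variable_difference = x - y" "place23 variable_difference = y - z"
    "place13 variable_difference = x - z"
    by (simp_all add: place_diff place_tensor2 x_y_z_def)
  have scale: "tscale (m\<^sup>2 - l * n) Z = (M\<^sup>2 - L * N) * Z" for Z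
    by (simp add: L_M_N_def power2_eq_square tscale_mult_left left_diff_distrib
        tscale.scale_left_diff_distrib)
  show ?thesis
    unfolding jacobi_element_def symbol diff scale by (simp add: algebra_simps power2_eq_square)
qed

lemma coeff_expand3_place:
  "coeff (expand3 (place12 X)) k = coeff (expand2 X) k \<otimes> 1"
  "coeff (expand3 (place13 X)) k = 1 \<otimes> coeff (expand2 X) k"
  by (induction X rule: poly_tensor_induct)
     (simp_all add: expand2_zero expand2_add expand2_scale expand3_zero expand3_add expand3_scale
       place_hom[THEN module_hom.zero] place_add place_scale tensor2_zero tensor2_linear
       ptensor_eq_tensor2 place_tensor2 expand2_tensor2 expand3_tensor3 coeff_map_poly
       tscale_mult_left tscale_mult_right mult.commute)

lemma expand3_place23: "expand3 (place23 X) = [:X:]"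
  by (induction X rule: poly_tensor_induct)
     (simp_all add: expand3_zero expand3_add expand3_scale place_hom[THEN module_hom.zero]
        place_add place_scale ptensor_eq_tensor2 place_tensor2 expand3_tensor3 tscale_mult_left)

lemma expand3_place_variable_difference:
  "expand3 (place12 variable_difference) = [:- (tvar \<otimes> 1), 1:]"
  "expand3 (place13 variable_difference) = [:- (1 \<otimes> tvar), 1:]"
  by (auto simp: poly_eq_iff coeff_expand3_place expand2_diff expand2_vars coeff_pCons tensor2_zero
      tensor2_one tensor2_minus split: nat.splits)

text \<open>
  The coefficient of \<open>x\<^sup>2\<close> in \<open>(x - y) (y - z) (x - z)\<close> is \<open>y - z\<close>, which is not a zero divisor.
\<close>

lemma jacobi_element_bilinear_symbol_eq_0_iff:
  "jacobi_element (bilinear_symbol l m n) = 0 \<longleftrightarrow> l * n - m\<^sup>2 = 0"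
proof
  assume "jacobi_element (bilinear_symbol l m n) = 0"
  then have "expand3 (tscale (m\<^sup>2 - l * n)
     (place12 variable_difference * place23 variable_difference * place13 variable_difference)) = 0"
    by (simp add: jacobi_element_bilinear_symbol expand3_zero)
  then have "coeff (expand3 (tscale (m\<^sup>2 - l * n)
     (place12 variable_difference * place23 variable_difference * place13 variable_difference))) 2 = 0"
    by simp
  then have "variable_difference * tscale (m\<^sup>2 - l * n) 1 = 0"
    by (simp add: expand3_scale expand3_mult expand3_place_variable_difference expand3_place23
       numeral_2_eq_2 mult.commute)
  then have "tscale (m\<^sup>2 - l * n) (1 \<otimes> 1) = 0"
    unfolding tensor2_one by (rule variable_difference_regular)
  from arg_cong[OF this, of expand2] show "l * n - m\<^sup>2 = 0"
    by (simp add: expand2_scale expand2_tensor2 expand2_zero)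
next
  assume "l * n - m\<^sup>2 = 0"
  then have "m\<^sup>2 - l * n = 0" by simp
  then show "jacobi_element (bilinear_symbol l m n) = 0"
    by (simp only: jacobi_element_bilinear_symbol tscale.scale_zero_left)
qed

section \<open>The degree bound\<close>

lemma coeff_mult_degree_bounds:
  assumes "degree p \<le> a" "degree q \<le> b"
  shows "coeff (p * q) (a + b) = coeff p a * coeff q b"
proof (cases "degree p = a \<and> degree q = b")
  case True
  then show ?thesis using coeff_mult_degree_sum by blast
next
  case False
  then have "degree p + degree q < a + b" using assms by linarith
  then have "coeff (p * q) (a + b) = 0"
    using degree_mult_le[of p q] by (intro coeff_eq_0) linarith
  moreover have "coeff p a = 0 \<or> coeff q b = 0"
    using False assms by (metis coeff_eq_0 le_neq_implies_less)
  ultimately show ?thesis by auto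
qed

text \<open>
  With \<open>p\<close> the leading coefficient in \<open>x\<close>, the coefficient of \<open>x^(2d)\<close> in \<open>jacobi_element s\<close> is
  \<open>(y - z) p(y) p(z)\<close> as soon as \<open>2d > d + 1\<close>.
\<close>

lemma degree_expand2_le_1:
  assumes reduced: "\<And>x::'a::comm_ring_1. x\<^sup>2 = 0 \<Longrightarrow> x = 0"
    and J: "jacobi_element (s :: ('a, 2) poly_tensor) = 0"
  shows "degree (expand2 s) \<le> 1"
proof (rule ccontr)
  define d where "d = degree (expand2 s)"
  define p where "p = coeff (expand2 s) d"
  assume "\<not> degree (expand2 s) \<le> 1"
  then have d: "d \<ge> 2" by (simp add: d_def)
  define S12 S13 where "S12 = expand3 (place12 s)" and "S13 = expand3 (place13 s)"
  have deg: "degree S12 \<le> d" "degree S13 \<le> d"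
    by (rule degree_le, simp add: S12_def S13_def coeff_expand3_place d_def coeff_eq_0 tensor2_zero)+
  have "0 = coeff (expand3 (jacobi_element s)) (d + d)" by (simp add: J expand3_zero)
  also have "expand3 (jacobi_element s) = smult variable_difference (S12 * S13)
      - smult s ([:- (1 \<otimes> tvar), 1:] * S12) + smult s ([:- (tvar \<otimes> 1), 1:] * S13)"
    unfolding jacobi_element_def expand3_add expand3_diff expand3_mult
      expand3_place_variable_difference expand3_place23 S12_def[symmetric] S13_def[symmetric]
    by (simp add: smult_diff_right mult.commute)
  also have "coeff \<dots> (d + d) = variable_difference * (coeff S12 d * coeff S13 d)"
  proof -
    have "coeff ([:a, 1:] * S) (d + d) = 0" if "degree S \<le> d" for a and S :: "('a, 2) poly_tensor poly"
    proof (rule coeff_eq_0)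
      have "degree ([:a, 1:] * S) \<le> Suc d"
        using degree_mult_le[of "[:a, 1:]" S] that by simp
      also have "Suc d < d + d" using d by linarith
      finally show "degree ([:a, 1:] * S) < d + d" .
    qed
    then show ?thesis
      using deg by (simp only: coeff_add coeff_diff coeff_smult coeff_mult_degree_bounds) simp
  qed
  also have "coeff S12 d * coeff S13 d = p \<otimes> p"
    by (simp add: S12_def S13_def coeff_expand3_place p_def tensor2_mult)
  finally have "p \<otimes> p = 0" using variable_difference_regular by metis
  \<comment> \<open>The diagonal coefficients of \<open>p \<otimes> p\<close> are the squares of the coefficients of \<open>p\<close>.\<close>
  from arg_cong[OF this, of expand2]
  have "coeff (coeff (expand2 (p \<otimes> p)) i) i = 0" for i by (simp add: expand2_zero)
  then have "(coeff p i)\<^sup>2 = 0" for i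
    by (simp add: expand2_tensor2 coeff_map_poly power2_eq_square)
  then have "p = 0" using reduced by (simp add: poly_eq_iff)
  then show False using d by (auto simp: p_def d_def)
qed

text \<open>
  Write \<open>s = p(y) + x q(y) = p(x) + y q(x)\<close>.  Comparing the coefficients of \<open>x\<^sup>0\<close> and \<open>x\<^sup>1\<close> bounds
  the degrees of \<open>p\<close> and \<open>q\<close> by 1 and identifies the two mixed coefficients.
\<close>

lemma symmetric_degree_le_1_imp_bilinear_symbol:
  assumes s: "exchange s = s" and deg: "degree (expand2 s) \<le> 1"
  shows "\<exists>l m n. s = bilinear_symbol l m n"
proof -
  define p q where "p = coeff (expand2 s) 0" and "q = coeff (expand2 s) 1"
  have "expand2 s = [:p, q:]"
    using deg by (auto simp: poly_eq_iff p_def q_def coeff_pCons coeff_eq_0 One_nat_def split: nat.splits)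
  then have s_eq: "s = 1 \<otimes> p + (tvar \<otimes> 1) * (1 \<otimes> q)"
    using tensor2_expansion[of s] by (simp add: map_poly_pCons tensor2_zero)
  have "s = p \<otimes> 1 + (1 \<otimes> tvar) * (q \<otimes> 1)"
    using s unfolding s_eq by (simp add: exchange_add exchange_mult exchange_tensor2)
  then have "[:p, q:] = expand2 (p \<otimes> 1 + (1 \<otimes> tvar) * (q \<otimes> 1))"
    using \<open>expand2 s = [:p, q:]\<close> by simp
  also have "\<dots> = map_poly (\<lambda>c. [:c:]) p + smult tvar (map_poly (\<lambda>c. [:c:]) q)"
    by (simp add: expand2_add expand2_mult expand2_vars expand2_tensor2)
  finally have "coeff [:p, q:] k = [:coeff p k, coeff q k:]" for k
    by (simp add: coeff_map_poly monom_altdef)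
  from this[of 0] this[of "Suc 0"]
  have pq: "p = [:coeff p 0, coeff q 0:]" "q = [:coeff p (Suc 0), coeff q (Suc 0):]"
    by (simp_all only: coeff_pCons_0 coeff_pCons_Suc)
  have "coeff [:coeff p 0, coeff q 0:] (Suc 0) = coeff q 0" by simp
  then have "coeff p (Suc 0) = coeff q 0" by (simp only: pq(1)[symmetric])
  with pq obtain l m n where lmn: "p = [:l, m:]" "q = [:m, n:]" by metis
  then have "s = bilinear_symbol l m n"
    unfolding s_eq lmn bilinear_symbol_def tensor2_pCons
    by (simp add: tensor2_zero tensor2_mult tscale_mult_left tscale_mult_right algebra_simps tscale.scale_right_distrib)
  then show ?thesis by blast
qed

lemma double_poisson_imp_bracket_value:
  assumes reduced: "\<And>x::'a::comm_ring_1. x\<^sup>2 = 0 \<Longrightarrow> x = 0"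
    and torsion_free: "\<And>x::'a. 2 * x = 0 \<Longrightarrow> x = 0"
    and \<phi>: "double_poisson (\<phi> :: ('a, 2) poly_tensor \<Rightarrow> _)"
  obtains l m n where "\<phi> = bracket_map (bracket_value l m n)" "l * n - m\<^sup>2 = 0"
proof -
  have bracket: "double_bracket \<phi>" using \<phi> by (simp add: double_poisson_def)
  note on_generator = double_bracket_value[OF bracket]
  obtain s where s: "\<phi> (tvar \<otimes> tvar) = variable_difference * s" "exchange s = s"
    using antisymmetric_factorization[OF torsion_free on_generator(1)] by blast
  have \<phi>_eq: "\<phi> = bracket_map (variable_difference * s)"
    using on_generator(2) s(1) by simp
  have J: "jacobi_element s = 0"
    using \<phi> double_poisson_bracket_map_iff[OF s(2)] \<phi>_eq by simp
  obtain l m n where lmn: "s = bilinear_symbol l m n"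
    using symmetric_degree_le_1_imp_bilinear_symbol[OF s(2) degree_expand2_le_1[OF reduced J]] by blast
  show thesis
    by (rule that[of l m n])
       (use J lmn \<phi>_eq in \<open>simp_all only: bracket_value_factorization jacobi_element_bilinear_symbol_eq_0_iff\<close>)
qed

section \<open>Homogeneity\<close>

lemma UNIV_2: "(UNIV :: 2 set) = {1, 2}"
  using exhaust_type_2 by auto

lemma tensor2_monom_in_grade: "monom a i \<otimes> monom b j \<in> tensor_grade (int i + int j)"
  unfolding tensor_grade_def tensor2_def
  by (rule tscale.span_base, rule CollectI, rule exI, rule exI[of _ "\<lambda>k. if k = 1 then i else j"])
     (auto simp: UNIV_2)

lemma tensor_grade_induct [consumes 1, case_names zero add]:
  assumes "X \<in> tensor_grade d" "P 0"
    and "\<And>c a b i j Y. int i + int j = d \<Longrightarrow> P Y \<Longrightarrow> P (tscale c (monom a i \<otimes> monom b j) + Y)"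
  shows "P X"
  using assms(1)[unfolded tensor_grade_def]
proof (induction rule: tscale.span_induct_alt)
  case (step c x y)
  then obtain f k where f: "x = ptensor f" "(\<Sum>i\<in>UNIV. int (k i)) = d" "\<forall>i. f i \<in> range (\<lambda>c. monom c (k i))"
    by blast
  then obtain a b where "f 1 = monom a (k 1)" "f 2 = monom b (k 2)" by blast
  with f show ?case using assms(3)[OF _ step(2)] by (simp add: ptensor_eq_tensor2 UNIV_2)
qed (rule assms(2))

lemma tensor_grade_add: "X \<in> tensor_grade d \<Longrightarrow> Y \<in> tensor_grade d \<Longrightarrow> X + Y \<in> tensor_grade d"
  unfolding tensor_grade_def by (rule tscale.span_add)

lemma tensor_grade_scale: "X \<in> tensor_grade d \<Longrightarrow> tscale c X \<in> tensor_grade d"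
  unfolding tensor_grade_def by (rule tscale.span_scale)

lemma tensor_grade_zero: "0 \<in> tensor_grade d"
  unfolding tensor_grade_def by (rule tscale.span_zero)

lemma tensor_grade_diff: "X \<in> tensor_grade d \<Longrightarrow> Y \<in> tensor_grade d \<Longrightarrow> X - Y \<in> tensor_grade d"
  unfolding tensor_grade_def by (rule tscale.span_diff)

lemma tensor_grade_mult:
  assumes "X \<in> tensor_grade d" "Y \<in> tensor_grade e"
  shows "X * Y \<in> (tensor_grade (d + e) :: ('a::comm_ring_1, 2) poly_tensor set)"
  using assms(1)
proof (induction rule: tensor_grade_induct)
  case (add c a b i j X)
  have "(monom a i \<otimes> monom b j) * Y \<in> tensor_grade (d + e)"
    using assms(2)
  proof (induction rule: tensor_grade_induct)
    case (add c' a' b' i' j' Y)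
    have "monom (a * a') (i + i') \<otimes> monom (b * b') (j + j') \<in> tensor_grade (d + e)"
      using tensor2_monom_in_grade[of "a * a'" "i + i'" "b * b'" "j + j'"] add.hyps \<open>int i + int j = d\<close>
      by (simp add: algebra_simps)
    then show ?case
      using add.IH by (simp add: distrib_left tscale_mult_right tensor2_mult mult_monom
          tensor_grade_add tensor_grade_scale)
  qed (simp add: tensor_grade_zero)
  then show ?case
    using add.IH by (simp add: distrib_right tscale_mult_left tensor_grade_add tensor_grade_scale)
qed (simp add: tensor_grade_zero)

text \<open>
  The degree is an integer: for \<open>k = 0\<close> it is \<open>-1\<close>, and the divided difference vanishes.
\<close>

lemma divided_difference_monom_in_grade:
  "divided_difference (monom c k) \<in> tensor_grade (int k - 1)"
proof (induction k)
  case 0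
  have "divided_difference (monom c 0) = 0"
    using divided_difference_pCons[of c 0] by (simp add: monom_0 divided_difference_zero tensor2_zero)
  then show ?case by (simp add: tensor_grade_zero)
next
  case (Suc k)
  have "(tvar \<otimes> 1) * divided_difference (monom c k) \<in> tensor_grade (1 + (int k - 1))"
    using tensor2_monom_in_grade[of 1 1 1 0] Suc.IH by (intro tensor_grade_mult) (simp_all add: monom_0 pCons_one)
  moreover have "1 \<otimes> monom c k \<in> tensor_grade (int k)"
    using tensor2_monom_in_grade[of 1 0 c k] by (simp add: monom_0 pCons_one)
  ultimately show ?case
    by (simp add: monom_Suc divided_difference_pCons tensor_grade_add)
qed

text \<open>
  Each of the two divided differences lowers the degree by 1.
\<close>

lemma homogeneous_bracket_map:
  assumes e: "e \<in> tensor_grade d"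
  shows "homogeneous_map (bracket_map e)"
  unfolding homogeneous_map_def
proof (intro exI[of _ "d - 2"] allI image_subsetI)
  interpret B: module_hom tscale tscale "bracket_map e" by (rule bracket_map_hom)
  fix n X assume "X \<in> (tensor_grade n :: ('a, 2) poly_tensor set)"
  then show "bracket_map e X \<in> tensor_grade (n + (d - 2))"
  proof (induction rule: tensor_grade_induct)
    case (add c a b i j Y)
    have "bracket_map e (monom a i \<otimes> monom b j) \<in> tensor_grade (d + (int i - 1) + (int j - 1))"
      unfolding bracket_map_tensor2
      by (intro tensor_grade_mult e divided_difference_monom_in_grade)
    also have "d + (int i - 1) + (int j - 1) = n + (d - 2)" using add.hyps by simp
    finally show ?case using add.IH by (simp add: B.add B.scale tensor_grade_add tensor_grade_scale)
  qed (simp add: B.zero tensor_grade_zero)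
qed

lemma coeff_expand2_grade:
  assumes "X \<in> tensor_grade d" "int i + int j \<noteq> d"
  shows "coeff (coeff (expand2 X) i) j = 0"
  using assms
  by (induction rule: tensor_grade_induct)
     (auto simp: expand2_zero expand2_add expand2_scale expand2_tensor2 coeff_map_poly)

lemma coeff_expand2_bracket_value:
  "coeff (coeff (expand2 (bracket_value l m n)) 1) 0 = l"
  "coeff (coeff (expand2 (bracket_value l m n)) 2) 0 = m"
  "coeff (coeff (expand2 (bracket_value l m n)) 2) 1 = n"
  unfolding bracket_value_def monom_power
  by (simp_all add: expand2_add expand2_diff expand2_scale expand2_tensor2
      coeff_map_poly coeff_pCons numeral_2_eq_2 One_nat_def)

lemma variable_power_in_grade: "tvar ^ i \<otimes> tvar ^ j \<in> tensor_grade (int i + int j)"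
  using tensor2_monom_in_grade[of 1 i 1 j] by (simp add: monom_power)

lemma basic_values_in_grade:
  "tvar \<otimes> 1 - 1 \<otimes> tvar \<in> (tensor_grade 1 :: ('a::comm_ring_1, 2) poly_tensor set)"
  "tvar\<^sup>2 \<otimes> tvar - tvar \<otimes> tvar\<^sup>2 \<in> (tensor_grade 3 :: ('a, 2) poly_tensor set)"
  using variable_power_in_grade[of 1 0, where ?'a = 'a] variable_power_in_grade[of 0 1, where ?'a = 'a]
    variable_power_in_grade[of 2 1, where ?'a = 'a] variable_power_in_grade[of 1 2, where ?'a = 'a]
  by (simp_all add: tensor_grade_diff)

theorem propositionA1:
  assumes reduced: "\<And>x::'a::comm_ring_1. x\<^sup>2 = 0 \<Longrightarrow> x = 0"
  shows
    "(let e1 = tvar \<otimes> 1 - 1 \<otimes> (tvar :: 'a poly);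
          e3 = tvar\<^sup>2 \<otimes> tvar - tvar \<otimes> (tvar :: 'a poly)\<^sup>2 in
        e3 = e1 * (tvar \<otimes> tvar) \<and> e1 \<in> tensor_grade 1 \<and> e3 \<in> tensor_grade 3 \<and>
        (\<exists>!\<phi>. double_bracket \<phi> \<and> \<phi> (tvar \<otimes> tvar) = e1) \<and>
        (\<exists>!\<phi>. double_bracket \<phi> \<and> \<phi> (tvar \<otimes> tvar) = e3) \<and>
        (\<forall>c. double_poisson (\<lambda>X. tscale c (bracket_of e1 X)) \<and>
             homogeneous_map (\<lambda>X. tscale c (bracket_of e1 X))) \<and>
        (\<forall>c. double_poisson (\<lambda>X. tscale c (bracket_of e3 X)) \<and>
             homogeneous_map (\<lambda>X. tscale c (bracket_of e3 X))) \<and>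
        ((\<forall>x::'a. 2 * x = 0 \<longrightarrow> x = 0) \<longrightarrow>
          (\<forall>\<phi>. double_poisson \<phi> \<and> homogeneous_map \<phi> \<longrightarrow>
             (\<exists>c. \<phi> = (\<lambda>X. tscale c (bracket_of e1 X))) \<or>
             (\<exists>c. \<phi> = (\<lambda>X. tscale c (bracket_of e3 X)))))) \<and>
     (\<forall>l m n :: 'a.
        (\<exists>!\<phi>. double_bracket \<phi> \<and> \<phi> (tvar \<otimes> tvar) = bracket_value l m n) \<and>
        (double_poisson (bracket_of (bracket_value l m n)) \<longleftrightarrow> l * n - m\<^sup>2 = 0)) \<and>
     ((\<forall>x::'a. 2 * x = 0 \<longrightarrow> x = 0) \<longrightarrow>
        (\<forall>\<phi> :: ('a, 2) poly_tensor \<Rightarrow> ('a, 2) poly_tensor. double_poisson \<phi> \<longrightarrow>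
           (\<exists>l m n. \<phi> = bracket_of (bracket_value l m n))))"
proof -
  define e1 :: "('a, 2) poly_tensor" where "e1 = tvar \<otimes> 1 - 1 \<otimes> tvar"
  define e3 :: "('a, 2) poly_tensor" where "e3 = tvar\<^sup>2 \<otimes> tvar - tvar \<otimes> tvar\<^sup>2"
  have multiples: "tscale c e1 = bracket_value c 0 0" "tscale c e3 = bracket_value 0 0 c" for c
    by (simp_all add: bracket_value_def e1_def e3_def)
  have as_values: "e1 = bracket_value 1 0 0" "e3 = bracket_value 0 0 1"
    using multiples[of 1] by simp_all
  have bracket_of_value: "bracket_of (bracket_value l m n) = bracket_map (bracket_value l m n)" for l m n :: 'a
    by (rule bracket_of_eq_bracket_map[OF exchange_bracket_value])
  have poisson_iff: "double_poisson (bracket_map (bracket_value l m n)) \<longleftrightarrow> l * n - m\<^sup>2 = 0" for l m n :: 'a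
    unfolding bracket_value_factorization
      double_poisson_bracket_map_iff[OF exchange_bilinear_symbol]
    by (rule jacobi_element_bilinear_symbol_eq_0_iff)
  have multiple_of: "(\<lambda>X. tscale c (bracket_of e1 X)) = bracket_map (bracket_value c 0 0)"
    "(\<lambda>X. tscale c (bracket_of e3 X)) = bracket_map (bracket_value 0 0 c)" for c
    unfolding multiples[symmetric] unfolding as_values bracket_of_value
    by (rule tscale_bracket_map)+
  have grade: "e1 \<in> tensor_grade 1" "e3 \<in> tensor_grade 3"
    unfolding e1_def e3_def by (rule basic_values_in_grade)+
  have product: "e3 = e1 * (tvar \<otimes> tvar)"
    by (simp add: e1_def e3_def left_diff_distrib tensor2_mult power2_eq_square)
  have unique: "\<exists>!\<phi>. double_bracket \<phi> \<and> \<phi> (tvar \<otimes> tvar) = bracket_value l m n" for l m n :: 'a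
    by (rule ex1_double_bracket[OF exchange_bracket_value])
  have poisson: "double_poisson (\<lambda>X. tscale c (bracket_of e1 X))"
    "double_poisson (\<lambda>X. tscale c (bracket_of e3 X))" for c
    by (simp_all add: multiple_of poisson_iff)
  have homogeneous: "homogeneous_map (\<lambda>X. tscale c (bracket_of e1 X))"
    "homogeneous_map (\<lambda>X. tscale c (bracket_of e3 X))" for c
    unfolding multiple_of multiples[symmetric]
    by (intro homogeneous_bracket_map[where d = 1] homogeneous_bracket_map[where d = 3]
        tensor_grade_scale grade)+
  have homogeneous_only: "(\<exists>c. \<phi> = (\<lambda>X. tscale c (bracket_of e1 X)))
      \<or> (\<exists>c. \<phi> = (\<lambda>X. tscale c (bracket_of e3 X)))"
    if torsion_free: "\<forall>x::'a. 2 * x = 0 \<longrightarrow> x = 0"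
      and "double_poisson \<phi>" and \<phi>_homogeneous: "homogeneous_map \<phi>" for \<phi>
  proof -
    obtain l m n where \<phi>: "\<phi> = bracket_map (bracket_value l m n)" and lmn: "l * n - m\<^sup>2 = 0"
      using double_poisson_imp_bracket_value[OF reduced _ \<open>double_poisson \<phi>\<close>] torsion_free by metis
    obtain d where "\<forall>n. \<phi> ` tensor_grade n \<subseteq> tensor_grade (n + d)"
      using \<phi>_homogeneous unfolding homogeneous_map_def by blast
    moreover have "tvar \<otimes> tvar \<in> (tensor_grade 2 :: ('a, 2) poly_tensor set)"
      using variable_power_in_grade[of 1 1] by simp
    ultimately have "bracket_value l m n \<in> tensor_grade (2 + d)"
      unfolding \<phi> by (metis bracket_map_tvar image_subset_iff)
    note coeff_0 = coeff_expand2_grade[OF this]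
    show ?thesis
    proof (cases "2 + d = 1")
      case True
      then have "n = 0"
        using coeff_0[of 2 1] unfolding coeff_expand2_bracket_value by simp
      moreover from this have "m = 0" using lmn reduced[of m] by simp
      ultimately show ?thesis using \<phi> by (auto simp: multiple_of)
    next
      case False
      then have "l = 0"
        using coeff_0[of 1 0] unfolding coeff_expand2_bracket_value by simp
      moreover from this have "m = 0" using lmn reduced[of m] by simp
      ultimately show ?thesis using \<phi> by (auto simp: multiple_of)
    qed
  qed
  have only: "\<exists>l m n. \<phi> = bracket_of (bracket_value l m n)"
    if "\<forall>x::'a. 2 * x = 0 \<longrightarrow> x = 0" "double_poisson \<phi>"
    for \<phi> :: "('a, 2) poly_tensor \<Rightarrow> ('a, 2) poly_tensor"
    using double_poisson_imp_bracket_value[OF reduced _ that(2)] that(1) bracket_of_value by metis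
  show ?thesis
    unfolding Let_def e1_def[symmetric] e3_def[symmetric]
  proof (intro conjI allI impI; (elim conjE)?)
    show "\<exists>!\<phi>. double_bracket \<phi> \<and> \<phi> (tvar \<otimes> tvar) = e1"
      "\<exists>!\<phi>. double_bracket \<phi> \<and> \<phi> (tvar \<otimes> tvar) = e3"
      unfolding as_values by (rule unique)+
    show "double_poisson (bracket_of (bracket_value l m n)) \<longleftrightarrow> l * n - m\<^sup>2 = 0" for l m n :: 'a
      unfolding bracket_of_value by (rule poisson_iff)
  qed (fact product grade unique poisson homogeneous | erule (2) homogeneous_only | erule (1) only)+
qed

end
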